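(* Let $\rho^{ab}$ be a state on $\mathcal H_a\otimes\mathcal H_b$, $\{|i\rangle\}_{i=1}^n$ an orthonormal basis of $\mathcal H_a$, $\eta_i=\mathrm{Tr}[(|i\rangle\langle i|\otimes I^b)\rho^{ab}]$ and (for $\eta_i>0$) $\omega_i=\eta_i^{-1}\sqrt{\rho^{ab}}(|i\rangle\langle i|\otimes I^b)\sqrt{\rho^{ab}}$. Then $$C^a_A(\rho^{ab})=P^{lsm}_E(\{\omega_i,\eta_i\}_{i=1}^n).$$
   Context: $C^a_A(\rho^{ab})=\min_{\sigma}(1-A^2(\rho^{ab},\sigma))$ over partial incoherent states $\sigma=\sum_ip_i|i\rangle\langle i|\otimes\sigma_i$, with $A(\rho,\sigma)=\mathrm{Tr}(\sqrt\rho\sqrt\sigma)$. For an ensemble $\{\rho_i,\eta_i\}$, let $\rho_{out}=\sum_i\eta_i\rho_i$ and $\rho_{out}^{-1/2}=\sum_k\lambda_k^{-1/2}P_k$ for the spectral decomposition $\rho_{out}=\sum_k\lambda_kP_k$ (sum over $\lambda_k>0$). The least square measurement (LSM) is $M^{lsm}_i=\eta_i\rho_{out}^{-1/2}\rho_i\rho_{out}^{-1/2}$, and its error probability is $P^{lsm}_E(\{\rho_i,\eta_i\})=1-\sum_i\eta_i\mathrm{Tr}(M^{lsm}_i\rho_i)$. *)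

theory Defs
  imports "Jordan_Normal_Form.Matrix" "Jordan_Normal_Form.Conjugate"
begin

definition adj :: "complex mat \<Rightarrow> complex mat" where
  "adj A = mat (dim_col A) (dim_row A) (\<lambda>(i,j). cnj (A $$ (j,i)))"

definition trace :: "complex mat \<Rightarrow> complex" where
  "trace A = (\<Sum>i<dim_row A. A $$ (i,i))"

definition unitary :: "nat \<Rightarrow> complex mat \<Rightarrow> bool" where
  "unitary n U \<longleftrightarrow> U \<in> carrier_mat n n \<and> adj U * U = 1\<^sub>m n"

definition hermitian :: "nat \<Rightarrow> complex mat \<Rightarrow> bool" where
  "hermitian n A \<longleftrightarrow> A \<in> carrier_mat n n \<and> adj A = A"

definition psd :: "nat \<Rightarrow> complex mat \<Rightarrow> bool" where
  "psd n A \<longleftrightarrow> hermitian n A \<and>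
     (\<forall>v \<in> carrier_vec n. 0 \<le> Re (conjugate v \<bullet> (A *\<^sub>v v)))"

definition density_op :: "nat \<Rightarrow> complex mat \<Rightarrow> bool" where
  "density_op n \<rho> \<longleftrightarrow> psd n \<rho> \<and> trace \<rho> = 1"

definition matfun :: "(real \<Rightarrow> real) \<Rightarrow> complex mat \<Rightarrow> complex mat" where
  "matfun f A = (SOME B. \<exists>U (d :: nat \<Rightarrow> real).
      unitary (dim_row A) U \<and>
      A = U * mat_diag (dim_row A) (\<lambda>k. complex_of_real (d k)) * adj U \<and>
      B = U * mat_diag (dim_row A) (\<lambda>k. complex_of_real (f (d k))) * adj U)"

definition msqrt :: "complex mat \<Rightarrow> complex mat" where
  "msqrt A = matfun sqrt A"

definition minvsqrt :: "complex mat \<Rightarrow> complex mat" where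
  "minvsqrt A = matfun (\<lambda>x. if x > 0 then 1 / sqrt x else 0) A"

definition kron :: "complex mat \<Rightarrow> complex mat \<Rightarrow> complex mat" where
  "kron A B = mat (dim_row A * dim_row B) (dim_col A * dim_col B)
     (\<lambda>(i,j). A $$ (i div dim_row B, j div dim_col B) * B $$ (i mod dim_row B, j mod dim_col B))"

definition ketbra :: "complex vec \<Rightarrow> complex vec \<Rightarrow> complex mat" where
  "ketbra v w = mat (dim_vec v) (dim_vec w) (\<lambda>(i,j). v $ i * cnj (w $ j))"

definition msum :: "nat \<Rightarrow> nat \<Rightarrow> ('i \<Rightarrow> complex mat) \<Rightarrow> 'i set \<Rightarrow> complex mat" where
  "msum r c f I = mat r c (\<lambda>(x,y). \<Sum>i\<in>I. f i $$ (x,y))"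

definition orthonormal_basis :: "nat \<Rightarrow> (nat \<Rightarrow> complex vec) \<Rightarrow> bool" where
  "orthonormal_basis n e \<longleftrightarrow> (\<forall>i<n. e i \<in> carrier_vec n) \<and>
     (\<forall>i<n. \<forall>j<n. conjugate (e i) \<bullet> e j = (if i = j then 1 else 0))"

definition affinity :: "complex mat \<Rightarrow> complex mat \<Rightarrow> real" where
  "affinity \<rho> \<sigma> = Re (trace (msqrt \<rho> * msqrt \<sigma>))"

definition partial_incoherent :: "nat \<Rightarrow> nat \<Rightarrow> (nat \<Rightarrow> complex vec) \<Rightarrow> complex mat set" where
  "partial_incoherent na nb e = {\<sigma>. \<exists>(p :: nat \<Rightarrow> real) (\<sigma>s :: nat \<Rightarrow> complex mat).
      (\<forall>i<na. 0 \<le> p i) \<and> (\<Sum>i<na. p i) = 1 \<and> (\<forall>i<na. density_op nb (\<sigma>s i)) \<and>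
      \<sigma> = msum (na*nb) (na*nb) (\<lambda>i. complex_of_real (p i) \<cdot>\<^sub>m kron (ketbra (e i) (e i)) (\<sigma>s i)) {..<na}}"

definition coh_A :: "nat \<Rightarrow> nat \<Rightarrow> (nat \<Rightarrow> complex vec) \<Rightarrow> complex mat \<Rightarrow> real" where
  "coh_A na nb e \<rho> = (INF \<sigma> \<in> partial_incoherent na nb e. 1 - (affinity \<rho> \<sigma>)\<^sup>2)"

definition rho_out :: "nat \<Rightarrow> nat \<Rightarrow> (nat \<Rightarrow> complex mat) \<Rightarrow> (nat \<Rightarrow> real) \<Rightarrow> complex mat" where
  "rho_out d n \<rho>s \<eta> = msum d d (\<lambda>i. complex_of_real (\<eta> i) \<cdot>\<^sub>m \<rho>s i) {..<n}"

definition lsm :: "nat \<Rightarrow> nat \<Rightarrow> (nat \<Rightarrow> complex mat) \<Rightarrow> (nat \<Rightarrow> real) \<Rightarrow> nat \<Rightarrow> complex mat" where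
  "lsm d n \<rho>s \<eta> i = (let R = minvsqrt (rho_out d n \<rho>s \<eta>) in
      complex_of_real (\<eta> i) \<cdot>\<^sub>m (R * \<rho>s i * R))"

definition P_lsm :: "nat \<Rightarrow> nat \<Rightarrow> (nat \<Rightarrow> complex mat) \<Rightarrow> (nat \<Rightarrow> real) \<Rightarrow> real" where
  "P_lsm d n \<rho>s \<eta> = 1 - (\<Sum>i<n. \<eta> i * Re (trace (lsm d n \<rho>s \<eta> i * \<rho>s i)))"

definition eta :: "nat \<Rightarrow> nat \<Rightarrow> (nat \<Rightarrow> complex vec) \<Rightarrow> complex mat \<Rightarrow> nat \<Rightarrow> real" where
  "eta na nb e \<rho> i = Re (trace (kron (ketbra (e i) (e i)) (1\<^sub>m nb) * \<rho>))"

text \<open>For \<open>\<eta>\<^sub>i = 0\<close> this is the zero matrix (since \<open>1/0 = 0\<close>); such indices carry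
  weight zero in the ensemble and do not affect \<open>P\<^sub>E\<close>.\<close>
definition omega :: "nat \<Rightarrow> nat \<Rightarrow> (nat \<Rightarrow> complex vec) \<Rightarrow> complex mat \<Rightarrow> nat \<Rightarrow> complex mat" where
  "omega na nb e \<rho> i = complex_of_real (1 / eta na nb e \<rho> i) \<cdot>\<^sub>m
      (msqrt \<rho> * kron (ketbra (e i) (e i)) (1\<^sub>m nb) * msqrt \<rho>)"

end

(*
  Let V_i = |i> (x) I, S = sqrt rho and K_i = V_i^* S V_i.  Both sides equal 1 - sum_i Tr(K_i^2).

  A partial incoherent state has the form sum_i V_i X_i^2 V_i^* with X_i >= 0 and sum_i |X_i|^2 = 1
  (Hilbert-Schmidt norm), and its square root is sum_i V_i X_i V_i^*.  So its affinity with rho is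
  the inner product sum_i Tr(K_i X_i), and by Cauchy-Schwarz the largest square is sum_i |K_i|^2,
  attained when X is proportional to K.  The K_i are not all 0, because sum_i Tr K_i = Tr S.

  On the measurement side eta_i omega_i = S V_i V_i^* S sums to rho, so conjugation by rho^(-1/2)
  turns it into P V_i V_i^* P with P the support projection of rho; since P S = S = S P the success
  probability is sum_i Tr(V_i V_i^* S V_i V_i^* S) = sum_i Tr(K_i^2).
*)
theory Submission
  imports "Jordan_Normal_Form.Spectral_Radius" Defs
begin

subsection \<open>Adjoints and the spectral theorem\<close>

text \<open>Square roots and inverse square roots come from \<open>matfun\<close>, a Hilbert choice
  over all diagonalizations. To compute with them one needs that a diagonalization exists and that
  the result does not depend on which one is taken. The former is proved by deflation, the latter by
  an intertwining argument; afterwards a positive square root is recognized by squaring it.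
  Cauchy-Schwarz is used in the form |K - t X|^2 >= 0 with t the affinity itself. This is an
  inequality between squared norms, so it adds up over the blocks without any square roots of norms.
  On the measurement side the weight eta_i occurs twice in each summand, once inside the measurement
  operator and once as the prior. Each copy cancels the normalization of one omega_i, so the
  computation runs on the unnormalized operators eta_i omega_i and covers eta_i = 0 as well.\<close>

lemma adj_dim [simp]: "dim_row (adj A) = dim_col A" "dim_col (adj A) = dim_row A"
  by (simp_all add: adj_def)

lemma adj_carrier [simp]: "A \<in> carrier_mat n m \<Longrightarrow> adj A \<in> carrier_mat m n"
  by (auto simp: adj_def)

lemma adj_index [simp]: "i < dim_col A \<Longrightarrow> j < dim_row A \<Longrightarrow> adj A $$ (i,j) = cnj (A $$ (j,i))"
  by (simp add: adj_def)

lemma adj_adj [simp]: "adj (adj A) = A"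
  by (rule eq_matI) auto

lemma mult_index_sum:
  "i < dim_row A \<Longrightarrow> j < dim_col B \<Longrightarrow> dim_col A = dim_row B \<Longrightarrow>
    (A * B) $$ (i,j) = (\<Sum>k<dim_row B. A $$ (i,k) * B $$ (k,j))"
  by (simp add: scalar_prod_def atLeast0LessThan)

lemma adj_mult [simp]: "dim_col A = dim_row B \<Longrightarrow> adj (A * B) = adj B * adj A"
  by (rule eq_matI) (auto simp: mult_index_sum mult.commute simp del: index_mult_mat(1))

lemma adj_one [simp]: "adj (1\<^sub>m n) = 1\<^sub>m n"
  by (rule eq_matI) auto

lemma adj_zero [simp]: "adj (0\<^sub>m n m) = 0\<^sub>m m n"
  by (rule eq_matI) auto

lemma adj_smult [simp]: "adj (c \<cdot>\<^sub>m A) = cnj c \<cdot>\<^sub>m adj A"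
  by (rule eq_matI) auto

lemma mat_diag_dims [simp]: "dim_row (mat_diag n f) = n" "dim_col (mat_diag n f) = n"
  by (simp_all add: mat_diag_def)

lemma adj_mat_diag_real [simp]:
  "adj (mat_diag n (\<lambda>k. complex_of_real (d k))) = mat_diag n (\<lambda>k. complex_of_real (d k))"
  by (rule eq_matI) (auto simp: mat_diag_def)

text \<open>In the carrier form of associativity the dimensions are variables that do not occur in
  the equation. Premises on \<open>dim_row\<close> and \<open>dim_col\<close> make it a rewrite rule
  for long products of rectangular matrices.\<close>

lemma mult_assoc_dim:
  "dim_col A = dim_row B \<Longrightarrow> dim_col B = dim_row C \<Longrightarrow>
    (A * B) * C = A * (B * (C :: 'a :: semiring_0 mat))"
  by (rule assoc_mult_mat[of _ "dim_row A" "dim_col A" _ "dim_col B" _ "dim_col C"]) auto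

lemma smult_mult_left:
  "dim_col A = dim_row B \<Longrightarrow> (c \<cdot>\<^sub>m A) * B = c \<cdot>\<^sub>m (A * (B :: 'a :: comm_ring_1 mat))"
  by (rule eq_matI) auto

lemma smult_mult_right:
  "dim_col A = dim_row B \<Longrightarrow> A * (c \<cdot>\<^sub>m B) = c \<cdot>\<^sub>m (A * (B :: 'a :: comm_ring_1 mat))"
  by (rule eq_matI) auto

lemma smult_smult_mat: "a \<cdot>\<^sub>m (b \<cdot>\<^sub>m A) = (a * b) \<cdot>\<^sub>m (A :: 'a :: comm_ring_1 mat)"
  by (rule eq_matI) (auto simp: mult.assoc)

lemma one_smult_mat [simp]: "1 \<cdot>\<^sub>m A = (A :: 'a :: comm_ring_1 mat)"
  by (rule eq_matI) auto

lemma one_mult_dim [simp]: "dim_row A = n \<Longrightarrow> 1\<^sub>m n * A = (A :: 'a :: comm_ring_1 mat)"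
  "dim_col A = n \<Longrightarrow> A * 1\<^sub>m n = (A :: 'a :: comm_ring_1 mat)"
  by (rule eq_matI; auto)+

lemma zero_mult_dim [simp]:
  "dim_row A = m \<Longrightarrow> 0\<^sub>m n m * A = 0\<^sub>m n (dim_col (A :: 'a :: comm_ring_1 mat))"
  "dim_col A = m \<Longrightarrow> A * 0\<^sub>m m n = 0\<^sub>m (dim_row (A :: 'a :: comm_ring_1 mat)) n"
  by (rule eq_matI; auto)+

section \<open>Unitary matrices and diagonalization of hermitian matrices\<close>

lemma unitaryD:
  assumes "unitary n U"
  shows "U \<in> carrier_mat n n" "dim_row U = n" "dim_col U = n" "adj U * U = 1\<^sub>m n" "U * adj U = 1\<^sub>m n"
proof -
  show "U \<in> carrier_mat n n" "dim_row U = n" "dim_col U = n" "adj U * U = 1\<^sub>m n"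
    using assms by (auto simp: unitary_def)
  then show "U * adj U = 1\<^sub>m n"
    using mat_mult_left_right_inverse[of "adj U" n U] by auto
qed

lemma unitary_cancel:
  assumes "unitary n U" "dim_row X = n"
  shows "adj U * (U * X) = X" "U * (adj U * X) = X"
  using unitaryD[OF assms(1)] assms(2) by (simp_all flip: mult_assoc_dim)

lemma unitary_mult:
  assumes "unitary n U" "unitary n V"
  shows "unitary n (U * V)"
  using unitaryD[OF assms(1)] unitaryD[OF assms(2)] unitary_cancel[OF assms(1), of V]
  by (auto simp: unitary_def mult_assoc_dim)

text \<open>Complete \<open>v\<close> to a basis and orthogonalize: Gram-Schmidt leaves the first
  vector unchanged, so after normalization the first column is still a multiple of
  \<open>v\<close>.\<close>

lemma unitary_first_col:
  assumes v: "v \<in> carrier_vec n" "v \<noteq> 0\<^sub>v n"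
  obtains W c where "unitary n W" "col W 0 = c \<cdot>\<^sub>v v"
proof -
  interpret cof_vec_space n "TYPE(complex)" .
  define b where "b = basis_completion v"
  define ws where "ws = gram_schmidt n b"
  have n: "n \<noteq> 0" using v by (metis carrier_vecD eq_vecI index_zero_vec(2) less_nat_zero_code)
  note bc = basis_completion[OF v, folded b_def]
  obtain vs where bv: "b = v # vs" using bc(6,7) n by (cases b) auto
  note gs = gram_schmidt_result[OF bc(2) bc(4) bc(5) refl, folded ws_def]
  have len: "length ws = n" using gs(4) bc(6) by simp
  have hd: "ws ! 0 = v"
  proof -
    have "ws \<noteq> []" using len n by auto
    then have "ws ! 0 = hd ws" by (cases ws) simp_all
    also have "hd ws = v" unfolding ws_def bv by (rule gram_schmidt_hd[OF v(1)])
    finally show ?thesis .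
  qed
  have wc: "ws ! i \<in> carrier_vec n" if "i < n" for i using gs(3) len that by auto
  define r where "r j = (\<Sum>k<n. (cmod (ws ! j $ k))\<^sup>2)" for j
  have ip: "ws ! j \<bullet>c ws ! i = (\<Sum>k<n. cnj (ws ! i $ k) * ws ! j $ k)" if "i < n" "j < n" for i j
    using wc[OF that(1)] wc[OF that(2)] by (simp add: scalar_prod_def atLeast0LessThan mult.commute)
  have orth: "(\<Sum>k<n. cnj (ws ! i $ k) * ws ! j $ k) = 0 \<longleftrightarrow> i \<noteq> j" if "i < n" "j < n" for i j
    using corthogonalD[OF gs(2), of j i] that len ip[OF that] by auto
  have self: "(\<Sum>k<n. cnj (ws ! i $ k) * ws ! i $ k) = of_real (r i)" for i
    by (simp add: r_def complex_norm_square[symmetric] mult.commute del: of_real_power)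
  have r0: "r i > 0" if "i < n" for i
  proof -
    have "r i \<noteq> 0" using orth[OF that that] self[of i] by auto
    moreover have "r i \<ge> 0" by (simp add: r_def sum_nonneg)
    ultimately show ?thesis by simp
  qed
  \<comment> \<open>The vectors \<open>ws\<close> are orthogonal but not normalized;
    \<open>r j\<close> is the squared norm of the j-th one.\<close>
  define W where "W = mat n n (\<lambda>(i,j). ws ! j $ i / of_real (sqrt (r j)))"
  have "unitary n W"
  proof -
    have "adj W * W = 1\<^sub>m n"
    proof (rule eq_matI)
      fix i j assume "i < dim_row (1\<^sub>m n :: complex mat)" "j < dim_col (1\<^sub>m n :: complex mat)"
      then have ij: "i < n" "j < n" by auto
      have "(adj W * W) $$ (i,j) = (\<Sum>k<n. cnj (W $$ (k,i)) * W $$ (k,j))"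
        using ij by (subst mult_index_sum) (auto simp: W_def)
      also have "\<dots> = (\<Sum>k<n. cnj (ws ! i $ k) * ws ! j $ k) / of_real (sqrt (r i) * sqrt (r j))"
        using ij by (simp add: W_def sum_divide_distrib)
      also have "\<dots> = (1\<^sub>m n) $$ (i,j)"
        using ij orth[OF ij] self[of i] r0[OF ij(1)] by (auto simp del: of_real_mult)
      finally show "(adj W * W) $$ (i,j) = (1\<^sub>m n) $$ (i,j)" .
    qed (auto simp: W_def)
    then show ?thesis by (auto simp: unitary_def W_def)
  qed
  moreover have "col W 0 = (1 / of_real (sqrt (r 0))) \<cdot>\<^sub>v v"
    using n v hd by (intro eq_vecI) (auto simp: W_def)
  ultimately show ?thesis by (rule that)
qed

lemma adj_four_block:
  assumes "A \<in> carrier_mat n1 m1" "B \<in> carrier_mat n1 m2" "C \<in> carrier_mat n2 m1" "D \<in> carrier_mat n2 m2"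
  shows "adj (four_block_mat A B C D) = four_block_mat (adj A) (adj C) (adj B) (adj D)"
  using assms by (intro eq_matI) (auto simp: four_block_mat_def)

text \<open>Deflation: a unitary whose first column is an eigenvector splits off a 1 x 1 block, and
  the remaining block is again hermitian and of smaller size.\<close>

lemma spectral_hermitian:
  assumes "hermitian n A"
  shows "\<exists>U (d :: nat \<Rightarrow> real). unitary n U \<and>
    A = U * mat_diag n (\<lambda>k. complex_of_real (d k)) * adj U"
  using assms
proof (induction n arbitrary: A)
  case 0
  then have "A = 1\<^sub>m 0 * mat_diag 0 (\<lambda>k. complex_of_real 0) * adj (1\<^sub>m 0)"
    by (intro eq_matI) (auto simp: hermitian_def)
  moreover have "unitary 0 (1\<^sub>m 0)" by (simp add: unitary_def)
  ultimately show ?case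
    by (intro exI[of _ "1\<^sub>m 0"] exI[of _ "\<lambda>_. 0"] conjI)
next
  case (Suc n)
  then have A: "A \<in> carrier_mat (Suc n) (Suc n)" "adj A = A" by (auto simp: hermitian_def)
  then have dA [simp]: "dim_row A = Suc n" "dim_col A = Suc n" by auto
  obtain e v where v: "v \<in> carrier_vec (Suc n)" "v \<noteq> 0\<^sub>v (Suc n)" "A *\<^sub>v v = e \<cdot>\<^sub>v v"
    using spectrum_non_empty[OF A(1)] A(1) by (auto simp: spectrum_def eigenvalue_def eigenvector_def)
  obtain W c where W: "unitary (Suc n) W" "col W 0 = c \<cdot>\<^sub>v v"
    using unitary_first_col[OF v(1,2)] .
  note WD = unitaryD[OF W(1)]
  note [simp] = WD(2,3)
  define B where "B = adj W * (A * W)"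
  have dB [simp]: "dim_row B = Suc n" "dim_col B = Suc n" by (auto simp: B_def)
  have hB: "adj B = B" using A(2) by (simp add: B_def mult_assoc_dim)
  have AB: "A = W * B * adj W"
    using unitary_cancel[OF W(1)] WD(5) by (simp add: B_def mult_assoc_dim)
  have ev: "A *\<^sub>v col W 0 = e \<cdot>\<^sub>v col W 0"
    using v A by (auto simp: W(2) mult_mat_vec smult_smult_assoc mult.commute)
  have B0: "B $$ (i,0) = (if i = 0 then e else 0)" if "i < Suc n" for i
  proof -
    have "B $$ (i,0) = row (adj W) i \<bullet> (A *\<^sub>v col W 0)"
      using that A by (simp add: B_def col_mult2[of A "Suc n" "Suc n" W "Suc n"] WD(1))
    also have "\<dots> = e * (row (adj W) i \<bullet> col W 0)"
      unfolding ev using that by simp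
    also have "row (adj W) i \<bullet> col W 0 = (adj W * W) $$ (i,0)" using that by simp
    also have "\<dots> = (if i = 0 then 1 else 0)" unfolding WD(4) using that by simp
    finally show ?thesis by simp
  qed
  \<comment> \<open>Hermiticity carries the zeros of the first column over to the first row, and at
    the corner it forces the eigenvalue to be real.\<close>
  have B0': "B $$ (0,i) = (if i = 0 then cnj e else 0)" if "i < Suc n" for i
    using arg_cong[OF hB, of "\<lambda>M. M $$ (0,i)"] B0[OF that] that by (auto split: if_splits)
  have ce: "cnj e = e" using B0[of 0] B0'[of 0] by simp
  then have re: "e = of_real (Re e)"
    using ce by (simp add: complex_eq_iff)
  define B3 where "B3 = mat n n (\<lambda>(i,j). B $$ (Suc i, Suc j))"
  have "cnj (B $$ (Suc j, Suc i)) = B $$ (Suc i, Suc j)" if "i < n" "j < n" for i j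
    using arg_cong[OF hB, of "\<lambda>M. M $$ (Suc i,Suc j)"] that by simp
  then have "hermitian n B3"
    unfolding hermitian_def B3_def by auto
  then obtain U d where U: "unitary n U" "B3 = U * mat_diag n (\<lambda>k. complex_of_real (d k)) * adj U"
    using Suc.IH by blast
  note UD = unitaryD[OF U(1)]
  define E where "E = mat 1 1 (\<lambda>_. e)"
  have E: "E \<in> carrier_mat 1 1" by (simp add: E_def)
  \<comment> \<open>The eigenvalue that was split off takes index 0; those of the smaller block move
    up by one.\<close>
  define d' where "d' = case_nat (Re e) d"
  define Y where "Y = four_block_mat (1\<^sub>m 1) (0\<^sub>m 1 n) (0\<^sub>m n 1) U"
  define Dg where "Dg = mat_diag n (\<lambda>k. complex_of_real (d k))"
  have Dg: "Dg \<in> carrier_mat n n" by (simp add: Dg_def)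
  have aY: "adj Y = four_block_mat (1\<^sub>m 1) (0\<^sub>m 1 n) (0\<^sub>m n 1) (adj U)"
    unfolding Y_def by (subst adj_four_block[OF _ _ _ UD(1)]) auto
  have one: "1\<^sub>m (Suc n) = four_block_mat (1\<^sub>m 1) (0\<^sub>m 1 n) (0\<^sub>m n 1) (1\<^sub>m n :: complex mat)"
    by (rule eq_matI) (auto simp: four_block_mat_def)
  have z: "(0\<^sub>m 1 n :: complex mat) \<in> carrier_mat 1 n" "(0\<^sub>m n 1 :: complex mat) \<in> carrier_mat n 1"
    "(1\<^sub>m 1 :: complex mat) \<in> carrier_mat 1 1" by auto
  have Yc: "Y \<in> carrier_mat (Suc n) (Suc n)"
    using UD(2,3) by (auto simp: Y_def)
  have "adj Y * Y = four_block_mat (1\<^sub>m 1) (0\<^sub>m 1 n) (0\<^sub>m n 1) (1\<^sub>m n)"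
    unfolding aY unfolding Y_def
    by (subst mult_four_block_mat[OF z(3) z(1) z(2) adj_carrier[OF UD(1)] z(3) z(1) z(2) UD(1)])
      (simp add: UD)
  then have uY: "unitary (Suc n) Y"
    unfolding unitary_def one using Yc by blast
  have Dd: "mat_diag (Suc n) (\<lambda>k. complex_of_real (d' k)) = four_block_mat E (0\<^sub>m 1 n) (0\<^sub>m n 1) Dg"
    by (rule eq_matI) (auto simp: four_block_mat_def mat_diag_def d'_def E_def Dg_def re[symmetric] split: nat.splits)
  have "B = four_block_mat E (0\<^sub>m 1 n) (0\<^sub>m n 1) B3"
    using B0 B0' ce by (intro eq_matI) (auto simp: four_block_mat_def E_def B3_def)
  also have "\<dots> = Y * four_block_mat E (0\<^sub>m 1 n) (0\<^sub>m n 1) Dg * adj Y"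
    unfolding aY unfolding Y_def U(2) Dg_def[symmetric]
    apply (subst mult_four_block_mat[OF z(3) z(1) z(2) UD(1) E z(1) z(2) Dg])
    apply (subst mult_four_block_mat[of _ 1 1 _ n _ n _ _ 1 _ n])
    using UD E Dg by auto
  finally have BY: "B = Y * mat_diag (Suc n) (\<lambda>k. complex_of_real (d' k)) * adj Y" unfolding Dd .
  have "A = (W * Y) * mat_diag (Suc n) (\<lambda>k. complex_of_real (d' k)) * adj (W * Y)"
    unfolding AB BY using Yc by (simp add: mult_assoc_dim)
  with unitary_mult[OF W(1) uY] show ?case by blast
qed

subsection \<open>Functional calculus and positive square roots\<close>

text \<open>Entrywise the hypothesis says that \<open>W $$ (i,j)\<close> can be nonzero only where
  \<open>d' i = d j\<close>, and there \<open>f (d' i) = f (d j)\<close> too.\<close>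

lemma mat_diag_intertwine:
  assumes W: "W \<in> carrier_mat n n"
    and "mat_diag n (\<lambda>k. complex_of_real (d' k)) * W = W * mat_diag n (\<lambda>k. complex_of_real (d k))"
  shows "mat_diag n (\<lambda>k. complex_of_real (f (d' k))) * W = W * mat_diag n (\<lambda>k. complex_of_real (f (d k)))"
proof (rule eq_matI)
  fix i j assume "i < dim_row (W * mat_diag n (\<lambda>k. complex_of_real (f (d k))))"
    "j < dim_col (W * mat_diag n (\<lambda>k. complex_of_real (f (d k))))"
  then have ij: "i < n" "j < n" using W by auto
  then have "of_real (d' i) * W $$ (i,j) = W $$ (i,j) * of_real (d j)"
    using arg_cong[OF assms(2), of "\<lambda>M. M $$ (i,j)"]
    by (simp add: mat_diag_mult_left[OF W] mat_diag_mult_right[OF W])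
  then have "W $$ (i,j) = 0 \<or> d' i = d j" by auto
  then show "(mat_diag n (\<lambda>k. complex_of_real (f (d' k))) * W) $$ (i,j)
      = (W * mat_diag n (\<lambda>k. complex_of_real (f (d k)))) $$ (i,j)"
    using ij by (auto simp: mat_diag_mult_left[OF W] mat_diag_mult_right[OF W])
qed (use W in auto)

text \<open>Removes the choice from \<open>matfun\<close>. For two diagonalizations of
  \<open>A\<close> by U and V, the change of basis W = V^* U intertwines the two diagonal matrices,
  hence also their images under \<open>f\<close>, so both give the same value.\<close>

lemma matfun_eq:
  assumes U: "unitary n U" and A: "A = U * mat_diag n (\<lambda>k. complex_of_real (d k)) * adj U"
  shows "matfun f A = U * mat_diag n (\<lambda>k. complex_of_real (f (d k))) * adj U"
proof -
  note UD = unitaryD[OF U]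
  have "dim_row A = n" by (simp add: A UD)
  have uniq: "V * mat_diag n (\<lambda>k. complex_of_real (f (d' k))) * adj V
      = U * mat_diag n (\<lambda>k. complex_of_real (f (d k))) * adj U"
    if V: "unitary n V" and A': "A = V * mat_diag n (\<lambda>k. complex_of_real (d' k)) * adj V" for V d'
  proof -
    note VD = unitaryD[OF V]
    note [simp] = UD(2,3) VD(2,3)
    define W where "W = adj V * U"
    have W: "W \<in> carrier_mat n n" "dim_row W = n" "dim_col W = n" by (auto simp: W_def)
    have UW: "V * W = U" unfolding W_def by (simp add: unitary_cancel[OF V])
    have "adj V * A * U = mat_diag n (\<lambda>k. complex_of_real (d' k)) * W"
      unfolding A' W_def by (simp add: mult_assoc_dim unitary_cancel[OF V])
    moreover have "adj V * A * U = W * mat_diag n (\<lambda>k. complex_of_real (d k))"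
      unfolding A W_def by (simp add: mult_assoc_dim UD(4))
    ultimately have "mat_diag n (\<lambda>k. complex_of_real (f (d' k))) * W
        = W * mat_diag n (\<lambda>k. complex_of_real (f (d k)))"
      using mat_diag_intertwine[of W n d' d f, OF W(1)] by simp
    then have "V * (mat_diag n (\<lambda>k. complex_of_real (f (d' k))) * W) * adj U
        = V * (W * mat_diag n (\<lambda>k. complex_of_real (f (d k)))) * adj U" by simp
    moreover have "V * (mat_diag n (\<lambda>k. complex_of_real (f (d' k))) * W) * adj U
        = V * mat_diag n (\<lambda>k. complex_of_real (f (d' k))) * adj V"
      unfolding W_def by (simp add: mult_assoc_dim UD(5))
    moreover have "V * (W * mat_diag n (\<lambda>k. complex_of_real (f (d k)))) * adj U
        = U * mat_diag n (\<lambda>k. complex_of_real (f (d k))) * adj U"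
      using W by (simp add: UW flip: mult_assoc_dim)
    ultimately show ?thesis by simp
  qed
  show ?thesis
    unfolding matfun_def \<open>dim_row A = n\<close>
  proof (rule some_equality)
    show "\<exists>V (d' :: nat \<Rightarrow> real). unitary n V \<and> A = V * mat_diag n (\<lambda>k. complex_of_real (d' k)) * adj V \<and>
        U * mat_diag n (\<lambda>k. complex_of_real (f (d k))) * adj U
          = V * mat_diag n (\<lambda>k. complex_of_real (f (d' k))) * adj V"
      using U A by blast
  qed (use uniq in blast)
qed

section \<open>The squared Hilbert-Schmidt norm and the trace\<close>

definition frob2 :: "complex mat \<Rightarrow> real" where
  "frob2 A = (\<Sum>j<dim_col A. \<Sum>i<dim_row A. (cmod (A $$ (i,j)))\<^sup>2)"

lemma frob2_nonneg: "frob2 A \<ge> 0"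
  by (simp add: frob2_def sum_nonneg)

lemma frob2_eq_0: "frob2 A = 0 \<longleftrightarrow> A = 0\<^sub>m (dim_row A) (dim_col A)"
proof
  assume "frob2 A = 0"
  then have "\<forall>j<dim_col A. \<forall>i<dim_row A. A $$ (i,j) = 0"
    unfolding frob2_def by (subst (asm) sum_nonneg_eq_0_iff; auto simp: sum_nonneg sum_nonneg_eq_0_iff)
  then show "A = 0\<^sub>m (dim_row A) (dim_col A)" by (intro eq_matI) auto
next
  assume A: "A = 0\<^sub>m (dim_row A) (dim_col A)"
  have "A $$ (i,j) = 0" if "i < dim_row A" "j < dim_col A" for i j
    using arg_cong[OF A, of "\<lambda>M. M $$ (i,j)"] that by simp
  then show "frob2 A = 0" by (simp add: frob2_def)
qed

lemma trace_index_sum: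
  "dim_col A = dim_row B \<Longrightarrow> dim_row A = dim_col B \<Longrightarrow>
    trace (A * B) = (\<Sum>j<dim_col B. \<Sum>i<dim_row B. A $$ (j,i) * B $$ (i,j))"
  by (auto simp: trace_def mult_index_sum simp del: index_mult_mat(1))

lemma trace_adj_mult: "trace (adj A * A) = complex_of_real (frob2 A)"
  by (simp add: trace_index_sum frob2_def complex_norm_square mult.commute del: of_real_power)

lemma trace_mult_comm:
  assumes "dim_col A = dim_row B" "dim_row A = dim_col B"
  shows "trace (A * B) = trace (B * A)"
proof -
  have "trace (A * B) = (\<Sum>j<dim_col B. \<Sum>i<dim_row B. A $$ (j,i) * B $$ (i,j))"
    using assms by (intro trace_index_sum)
  also have "\<dots> = (\<Sum>i<dim_row B. \<Sum>j<dim_col B. B $$ (i,j) * A $$ (j,i))"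
    by (subst sum.swap) (simp only: mult.commute)
  also have "\<dots> = trace (B * A)"
    using assms by (subst trace_index_sum) simp_all
  finally show ?thesis .
qed

lemma trace_smult: "dim_row A = dim_col A \<Longrightarrow> trace (c \<cdot>\<^sub>m A) = c * trace A"
  by (auto simp: trace_def sum_distrib_left)

text \<open>The entrywise inequality |a - t b|^2 >= 0, summed. The free real \<open>t\<close> stands
  in for the usual product of norms and is chosen only after summing over blocks.\<close>

lemma trace_adj_mult_le:
  assumes "dim_row A = dim_row B" "dim_col A = dim_col B"
  shows "2 * t * Re (trace (adj A * B)) \<le> frob2 A + t\<^sup>2 * frob2 B"
proof -
  have *: "2 * t * Re (cnj a * b) \<le> (cmod a)\<^sup>2 + t\<^sup>2 * (cmod b)\<^sup>2" for a b
    using sum_power2_ge_zero[of "Re a - t * Re b" "Im a - t * Im b"]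
    unfolding cmod_power2 by (simp add: power2_eq_square algebra_simps)
  have "2 * t * Re (trace (adj A * B))
      = (\<Sum>j<dim_col B. \<Sum>i<dim_row B. 2 * t * Re (cnj (A $$ (i,j)) * B $$ (i,j)))"
    using assms by (simp add: trace_index_sum sum_distrib_left sum.distrib distrib_left)
  also have "\<dots> \<le> (\<Sum>j<dim_col B. \<Sum>i<dim_row B. (cmod (A $$ (i,j)))\<^sup>2 + t\<^sup>2 * (cmod (B $$ (i,j)))\<^sup>2)"
    by (intro sum_mono *)
  also have "\<dots> = frob2 A + t\<^sup>2 * frob2 B"
    using assms by (simp add: frob2_def sum_distrib_left sum.distrib)
  finally show ?thesis .
qed

lemma frob2_smult: "frob2 (c \<cdot>\<^sub>m A) = (cmod c)\<^sup>2 * frob2 A"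
  by (simp add: frob2_def sum_distrib_left norm_mult power_mult_distrib)

section \<open>Positive semidefinite matrices and their square roots\<close>

lemma psdD:
  assumes "psd n A"
  shows "A \<in> carrier_mat n n" "dim_row A = n" "dim_col A = n" "adj A = A"
  using assms by (auto simp: psd_def hermitian_def)

lemma quad_form:
  assumes "A \<in> carrier_mat n n" "v \<in> carrier_vec n"
  shows "conjugate v \<bullet> (A *\<^sub>v v) = (\<Sum>i<n. \<Sum>j<n. cnj (v $ i) * A $$ (i,j) * v $ j)"
proof -
  have "conjugate v \<bullet> (A *\<^sub>v v) = (\<Sum>i<n. cnj (v $ i) * (\<Sum>j<n. A $$ (i,j) * v $ j))"
    using assms unfolding scalar_prod_def atLeast0LessThan
    by (intro sum.cong) (auto simp: scalar_prod_def atLeast0LessThan)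
  then show ?thesis by (simp only: sum_distrib_left mult.assoc)
qed

text \<open>The quadratic form of X^* X at v is the squared norm of X v. Congruences, squares and
  unitary conjugates of nonnegative diagonals are later brought into this shape to see that they are
  positive.\<close>

lemma psd_adj_mult: "psd (dim_col X) (adj X * X)"
proof -
  have "0 \<le> Re (conjugate v \<bullet> ((adj X * X) *\<^sub>v v))" if v: "v \<in> carrier_vec (dim_col X)" for v
  proof -
    have "conjugate v \<bullet> ((adj X * X) *\<^sub>v v)
        = (\<Sum>i<dim_col X. \<Sum>j<dim_col X. \<Sum>k<dim_row X. cnj (v $ i) * cnj (X $$ (k,i)) * X $$ (k,j) * v $ j)"
      using v by (subst quad_form)
        (auto simp: mult_index_sum sum_distrib_left sum_distrib_right mult.assoc simp del: index_mult_mat(1))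
    also have "\<dots> = (\<Sum>k<dim_row X. \<Sum>i<dim_col X. \<Sum>j<dim_col X. cnj (v $ i) * cnj (X $$ (k,i)) * X $$ (k,j) * v $ j)"
      by (subst (2) sum.swap, subst sum.swap) (rule refl)
    also have "\<dots> = (\<Sum>k<dim_row X. cnj (\<Sum>i<dim_col X. X $$ (k,i) * v $ i) * (\<Sum>i<dim_col X. X $$ (k,i) * v $ i))"
      unfolding cnj_sum sum_product by (simp add: mult_ac)
    also have "\<dots> = of_real (\<Sum>k<dim_row X. (cmod (\<Sum>i<dim_col X. X $$ (k,i) * v $ i))\<^sup>2)"
      by (simp add: complex_norm_square mult.commute del: of_real_power)
    finally show ?thesis by (simp add: sum_nonneg)
  qed
  then show ?thesis by (auto simp: psd_def hermitian_def)
qed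

text \<open>The k-th eigenvalue is the quadratic form of \<open>A\<close> at the k-th column of U,
  hence nonnegative.\<close>

lemma psd_spectral:
  assumes "psd n A"
  obtains U d where "unitary n U" "A = U * mat_diag n (\<lambda>k. complex_of_real (d k)) * adj U"
    "\<And>k. k < n \<Longrightarrow> d k \<ge> (0 :: real)"
proof -
  obtain U d where U: "unitary n U" and A: "A = U * mat_diag n (\<lambda>k. complex_of_real (d k)) * adj U"
    using spectral_hermitian[of n A] assms by (auto simp: psd_def)
  note UD = unitaryD[OF U]
  have "d k \<ge> 0" if k: "k < n" for k
  proof -
    have "adj U * (A * U) = mat_diag n (\<lambda>k. complex_of_real (d k))"
      unfolding A using UD by (simp add: mult_assoc_dim unitary_cancel[OF U])
    then have "complex_of_real (d k) = (adj U * (A * U)) $$ (k,k)" using k by (simp add: mat_diag_def)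
    also have "\<dots> = row (adj U) k \<bullet> (A *\<^sub>v col U k)"
      using k UD psdD[OF assms] by (simp add: col_mult2[of A n n U n])
    also have "row (adj U) k = conjugate (col U k)"
      using k UD by (intro eq_vecI) auto
    finally have "d k = Re (conjugate (col U k) \<bullet> (A *\<^sub>v col U k))" by (metis Re_complex_of_real)
    moreover have "col U k \<in> carrier_vec n" using UD by auto
    ultimately show ?thesis using assms by (auto simp: psd_def)
  qed
  with U A that show ?thesis by blast
qed

lemma mat_diag_sqrt_square:
  assumes "\<And>k. k < n \<Longrightarrow> d k \<ge> (0 :: real)"
  shows "mat_diag n (\<lambda>k. complex_of_real (sqrt (d k))) * mat_diag n (\<lambda>k. complex_of_real (sqrt (d k)))
      = mat_diag n (\<lambda>k. complex_of_real (d k))"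
proof -
  have "complex_of_real (sqrt (d k)) * complex_of_real (sqrt (d k)) = complex_of_real (d k)"
    if "k < n" for k
    unfolding of_real_mult[symmetric] using assms[OF that] by simp
  then show ?thesis
    unfolding mat_diag_diag by (auto simp: mat_diag_def simp del: of_real_mult)
qed

lemma psd_unitary_diag:
  assumes U: "unitary n U" and d: "\<And>k. k < n \<Longrightarrow> d k \<ge> (0 :: real)"
  shows "psd n (U * mat_diag n (\<lambda>k. complex_of_real (d k)) * adj U)"
proof -
  note UD = unitaryD[OF U]
  define X where "X = mat_diag n (\<lambda>k. complex_of_real (sqrt (d k))) * adj U"
  have "mat_diag n (\<lambda>k. complex_of_real (sqrt (d k))) * mat_diag n (\<lambda>k. complex_of_real (sqrt (d k)))
      = mat_diag n (\<lambda>k. complex_of_real (d k))" (is "?D * ?D = _")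
    by (rule mat_diag_sqrt_square[OF d])
  moreover have "adj X * X = U * (?D * ?D) * adj U"
    using UD unfolding X_def by (simp add: mult_assoc_dim del: mat_diag_diag)
  ultimately have "adj X * X = U * mat_diag n (\<lambda>k. complex_of_real (d k)) * adj U" by simp
  moreover have "dim_col X = n" using UD by (simp add: X_def)
  ultimately show ?thesis using psd_adj_mult[of X] by simp
qed

lemma msqrt_psd:
  assumes "psd n A"
  shows "psd n (msqrt A)" "msqrt A * msqrt A = A"
proof -
  obtain U d where U: "unitary n U" and A: "A = U * mat_diag n (\<lambda>k. complex_of_real (d k)) * adj U"
    and d: "\<And>k. k < n \<Longrightarrow> d k \<ge> (0 :: real)" by (rule psd_spectral[OF assms]) blast
  note UD = unitaryD[OF U]
  have s: "msqrt A = U * mat_diag n (\<lambda>k. complex_of_real (sqrt (d k))) * adj U"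
    unfolding msqrt_def by (rule matfun_eq[OF U A])
  show "psd n (msqrt A)" unfolding s by (rule psd_unitary_diag[OF U]) (use d in auto)
  have "mat_diag n (\<lambda>k. complex_of_real (sqrt (d k))) * mat_diag n (\<lambda>k. complex_of_real (sqrt (d k)))
      = mat_diag n (\<lambda>k. complex_of_real (d k))" (is "?D * ?D = _")
    by (rule mat_diag_sqrt_square[OF d])
  moreover have "msqrt A * msqrt A = U * (?D * ?D) * adj U"
    unfolding s using UD by (simp add: mult_assoc_dim unitary_cancel[OF U] del: mat_diag_diag)
  ultimately show "msqrt A * msqrt A = A" by (simp add: A)
qed

text \<open>Uniqueness of the positive root: a diagonalization of \<open>B\<close> also diagonalizes
  \<open>B * B\<close>, and sqrt (x * x) = x for the nonnegative eigenvalues x.\<close>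

lemma msqrt_square:
  assumes "psd n B"
  shows "msqrt (B * B) = B"
proof -
  obtain U d where U: "unitary n U" and B: "B = U * mat_diag n (\<lambda>k. complex_of_real (d k)) * adj U"
    and d: "\<And>k. k < n \<Longrightarrow> d k \<ge> (0 :: real)" by (rule psd_spectral[OF assms]) blast
  note UD = unitaryD[OF U]
  have "B * B = U * (mat_diag n (\<lambda>k. complex_of_real (d k)) * mat_diag n (\<lambda>k. complex_of_real (d k))) * adj U"
    unfolding B using UD by (simp add: mult_assoc_dim unitary_cancel[OF U] del: mat_diag_diag)
  then have "B * B = U * mat_diag n (\<lambda>k. complex_of_real (d k * d k)) * adj U" by simp
  from matfun_eq[OF U this, of sqrt]
  have "msqrt (B * B) = U * mat_diag n (\<lambda>k. complex_of_real (sqrt (d k * d k))) * adj U"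
    by (simp add: msqrt_def)
  also have "mat_diag n (\<lambda>k. complex_of_real (sqrt (d k * d k))) = mat_diag n (\<lambda>k. complex_of_real (d k))"
    using d by (intro eq_matI) (auto simp: mat_diag_def)
  finally show ?thesis by (simp add: B)
qed

text \<open>The product below is the projection onto the support of \<open>A\<close>, which fixes \<open>msqrt A\<close>.\<close>
lemma minvsqrt_msqrt:
  assumes "psd n A"
  defines "P \<equiv> minvsqrt A * msqrt A"
  shows "minvsqrt A \<in> carrier_mat n n" "msqrt A * minvsqrt A = P"
    "P * msqrt A = msqrt A" "msqrt A * P = msqrt A"
proof -
  obtain U d where U: "unitary n U" and A: "A = U * mat_diag n (\<lambda>k. complex_of_real (d k)) * adj U"
    and d: "\<And>k. k < n \<Longrightarrow> d k \<ge> (0 :: real)" by (rule psd_spectral[OF assms(1)]) blast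
  note UD = unitaryD[OF U]
  define M where "M f = U * mat_diag n (\<lambda>k. complex_of_real (f (d k))) * adj U" for f
  have M: "M f * M g = M (\<lambda>x. f x * g x)" for f g
  proof -
    have "M f * M g = U * (mat_diag n (\<lambda>k. complex_of_real (f (d k))) * mat_diag n (\<lambda>k. complex_of_real (g (d k)))) * adj U"
      unfolding M_def using UD by (simp add: mult_assoc_dim unitary_cancel[OF U] del: mat_diag_diag)
    then show ?thesis by (simp add: M_def)
  qed
  \<comment> \<open>Only arguments x \<ge> 0 matter, since all eigenvalues of \<open>A\<close> are
    nonnegative. For negative x the identities below would fail: the real \<open>sqrt\<close> is
    then negative while \<open>h\<close> is 0.\<close>
  have cong: "M f = M g" if "\<And>x. x \<ge> 0 \<Longrightarrow> f x = g x" for f g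
    unfolding M_def using d that
    by (intro arg_cong2[where f = "(*)"] refl eq_matI) (auto simp: mat_diag_def)
  define h :: "real \<Rightarrow> real" where "h x = (if x > 0 then 1 / sqrt x else 0)" for x
  have s: "msqrt A = M sqrt" and r: "minvsqrt A = M h"
    unfolding msqrt_def minvsqrt_def M_def h_def by (rule matfun_eq[OF U A])+
  show "minvsqrt A \<in> carrier_mat n n" unfolding r M_def using UD by auto
  show "msqrt A * minvsqrt A = P" "P * msqrt A = msqrt A" "msqrt A * P = msqrt A"
    unfolding P_def s r M by (rule cong; simp add: h_def)+
qed

lemma psd_congr:
  assumes "psd n A" "dim_row V = n"
  shows "psd (dim_col V) (adj V * A * V)"
proof -
  note S = psdD[OF msqrt_psd(1)[OF assms(1)]]
  have "adj (msqrt A * V) * (msqrt A * V) = adj V * (msqrt A * msqrt A) * V"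
    using S assms(2) by (simp add: mult_assoc_dim)
  then show ?thesis using psd_adj_mult[of "msqrt A * V"] S msqrt_psd(2)[OF assms(1)] by simp
qed

lemma psd_square:
  assumes "psd n A"
  shows "psd n (A * A)"
  using psd_adj_mult[of A] by (simp add: psdD[OF assms])

lemma psd_smult:
  assumes "psd n A" "c \<ge> 0"
  shows "psd n (complex_of_real c \<cdot>\<^sub>m A)"
proof -
  have "conjugate v \<bullet> ((complex_of_real c \<cdot>\<^sub>m A) *\<^sub>v v) = of_real c * (conjugate v \<bullet> (A *\<^sub>v v))"
    if "v \<in> carrier_vec n" for v
    using that psdD(1)[OF assms(1)]
    by (simp add: quad_form quad_form[OF smult_carrier_mat] sum_distrib_left mult_ac)
  then show ?thesis using assms by (auto simp: psd_def hermitian_def)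
qed

lemma trace_psd_square:
  assumes "psd n A"
  shows "trace (A * A) = complex_of_real (frob2 A)"
  using trace_adj_mult[of A] by (simp add: psdD[OF assms])

text \<open>The trace of a positive matrix is the squared Hilbert-Schmidt norm of its square root,
  which vanishes only for the zero matrix.\<close>

lemma psd_trace_0:
  assumes "psd n A" "trace A = 0"
  shows "A = 0\<^sub>m n n"
proof -
  note S = psdD[OF msqrt_psd(1)[OF assms(1)]]
  have "frob2 (msqrt A) = 0"
    using trace_psd_square[OF msqrt_psd(1)[OF assms(1)]] msqrt_psd(2)[OF assms(1)] assms(2) by simp
  then have "msqrt A = 0\<^sub>m n n" by (simp add: frob2_eq_0 S)
  then show ?thesis using msqrt_psd(2)[OF assms(1)] by simp
qed

subsection \<open>Sums of matrices\<close>

lemma msum_carrier [simp]: "msum r c f I \<in> carrier_mat r c"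
  by (simp add: msum_def)

lemma msum_dim [simp]: "dim_row (msum r c f I) = r" "dim_col (msum r c f I) = c"
  by (simp_all add: msum_def)

lemma msum_index [simp]: "x < r \<Longrightarrow> y < c \<Longrightarrow> msum r c f I $$ (x,y) = (\<Sum>i\<in>I. f i $$ (x,y))"
  by (simp add: msum_def)

lemma msum_cong: "(\<And>i. i \<in> I \<Longrightarrow> f i = g i) \<Longrightarrow> msum r c f I = msum r c g I"
  by (intro eq_matI) auto

lemma msum_mult_left:
  assumes "\<And>i. i \<in> I \<Longrightarrow> f i \<in> carrier_mat r c" "A \<in> carrier_mat m r"
  shows "A * msum r c f I = msum m c (\<lambda>i. A * f i) I"
proof (rule eq_matI)
  fix x y assume "x < dim_row (msum m c (\<lambda>i. A * f i) I)" "y < dim_col (msum m c (\<lambda>i. A * f i) I)"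
  then have xy: "x < m" "y < c" by auto
  have dims: "dim_row A = m" "dim_col A = r" "\<And>i. i \<in> I \<Longrightarrow> dim_row (f i) = r"
    "\<And>i. i \<in> I \<Longrightarrow> dim_col (f i) = c" using assms by auto
  have "(A * msum r c f I) $$ (x,y) = (\<Sum>k<r. \<Sum>i\<in>I. A $$ (x,k) * f i $$ (k,y))"
    using xy dims by (simp add: mult_index_sum sum_distrib_left del: index_mult_mat(1))
  also have "\<dots> = (\<Sum>i\<in>I. \<Sum>k<r. A $$ (x,k) * f i $$ (k,y))" by (rule sum.swap)
  also have "\<dots> = msum m c (\<lambda>i. A * f i) I $$ (x,y)"
    using xy dims by (simp add: mult_index_sum del: index_mult_mat(1))
  finally show "(A * msum r c f I) $$ (x,y) = msum m c (\<lambda>i. A * f i) I $$ (x,y)" .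
qed (use assms in auto)

lemma adj_msum:
  assumes "\<And>i. i \<in> I \<Longrightarrow> f i \<in> carrier_mat r c"
  shows "adj (msum r c f I) = msum c r (\<lambda>i. adj (f i)) I"
proof (rule eq_matI)
  fix x y assume "x < dim_row (msum c r (\<lambda>i. adj (f i)) I)" "y < dim_col (msum c r (\<lambda>i. adj (f i)) I)"
  moreover have "\<And>i. i \<in> I \<Longrightarrow> dim_row (f i) = r" "\<And>i. i \<in> I \<Longrightarrow> dim_col (f i) = c"
    using assms by auto
  ultimately show "adj (msum r c f I) $$ (x,y) = msum c r (\<lambda>i. adj (f i)) I $$ (x,y)" by simp
qed auto

text \<open>Follows from multiplication on the left, because adjoints reverse products and pass
  through \<open>msum\<close>.\<close>

lemma msum_mult_right:
  assumes f: "\<And>i. i \<in> I \<Longrightarrow> f i \<in> carrier_mat r c" and A: "A \<in> carrier_mat c m"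
  shows "msum r c f I * A = msum r m (\<lambda>i. f i * A) I"
proof -
  have "adj (msum r c f I * A) = adj A * msum c r (\<lambda>i. adj (f i)) I"
    using A by (simp add: adj_msum[OF f])
  also have "\<dots> = msum m r (\<lambda>i. adj A * adj (f i)) I"
    using A f by (subst msum_mult_left[of I _ c r]) auto
  also have "\<dots> = msum m r (\<lambda>i. adj (f i * A)) I"
  proof (rule msum_cong)
    fix i assume "i \<in> I"
    then show "adj A * adj (f i) = adj (f i * A)" using A f[of i] by auto
  qed
  also have "\<dots> = adj (msum r m (\<lambda>i. f i * A) I)"
    by (rule adj_msum[symmetric]) (rule mult_carrier_mat[OF f A])
  finally show ?thesis by (metis adj_adj)
qed

lemma trace_msum:
  assumes "\<And>i. i \<in> I \<Longrightarrow> f i \<in> carrier_mat n n"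
  shows "trace (msum n n f I) = (\<Sum>i\<in>I. trace (f i))"
proof -
  have "dim_row (f i) = n" if "i \<in> I" for i using assms[OF that] by auto
  then show ?thesis by (auto simp: trace_def intro: sum.swap)
qed

lemma msum_mult_orthogonal:
  assumes "finite I"
    and f: "\<And>i. i \<in> I \<Longrightarrow> f i \<in> carrier_mat n n" and g: "\<And>i. i \<in> I \<Longrightarrow> g i \<in> carrier_mat n n"
    and orth: "\<And>i j. i \<in> I \<Longrightarrow> j \<in> I \<Longrightarrow> i \<noteq> j \<Longrightarrow> f i * g j = 0\<^sub>m n n"
  shows "msum n n f I * msum n n g I = msum n n (\<lambda>i. f i * g i) I"
proof -
  have "msum n n f I * msum n n g I = msum n n (\<lambda>i. f i * msum n n g I) I"
    by (rule msum_mult_right) (use f in auto)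
  also have "\<dots> = msum n n (\<lambda>i. f i * g i) I"
  proof (rule msum_cong)
    fix i assume i: "i \<in> I"
    have "f i * msum n n g I = msum n n (\<lambda>j. f i * g j) I"
      by (rule msum_mult_left) (use f g i in auto)
    also have "\<dots> = f i * g i"
    proof (rule eq_matI)
      fix x y assume "x < dim_row (f i * g i)" "y < dim_col (f i * g i)"
      then have xy: "x < n" "y < n" using f[OF i] g[OF i] by auto
      have "(\<Sum>j\<in>I. (f i * g j) $$ (x,y)) = (\<Sum>j\<in>I. if i = j then (f i * g i) $$ (x,y) else 0)"
        using orth[OF i] xy by (intro sum.cong refl) auto
      then show "msum n n (\<lambda>j. f i * g j) I $$ (x,y) = (f i * g i) $$ (x,y)"
        using xy i assms(1) by simp
    qed (use f[OF i] g[OF i] in auto)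
    finally show "f i * msum n n g I = f i * g i" .
  qed
  finally show ?thesis .
qed

lemma psd_msum:
  assumes "\<And>i. i \<in> I \<Longrightarrow> psd n (f i)"
  shows "psd n (msum n n f I)"
proof -
  have "adj (msum n n f I) = msum n n f I"
    using psdD[OF assms] by (simp add: adj_msum cong: msum_cong)
  moreover have "0 \<le> Re (conjugate v \<bullet> (msum n n f I *\<^sub>v v))" if v: "v \<in> carrier_vec n" for v
  proof -
    have "conjugate v \<bullet> (msum n n f I *\<^sub>v v)
        = (\<Sum>x<n. \<Sum>y<n. \<Sum>i\<in>I. cnj (v $ x) * f i $$ (x,y) * v $ y)"
      using v by (subst quad_form) (auto simp: sum_distrib_left sum_distrib_right)
    also have "\<dots> = (\<Sum>i\<in>I. \<Sum>x<n. \<Sum>y<n. cnj (v $ x) * f i $$ (x,y) * v $ y)"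
      by (subst (2) sum.swap, subst sum.swap) (rule refl)
    also have "\<dots> = (\<Sum>i\<in>I. conjugate v \<bullet> (f i *\<^sub>v v))"
      using v psdD(1)[OF assms] by (intro sum.cong refl) (subst quad_form, auto)
    finally show ?thesis
      using assms v by (auto simp: psd_def intro!: sum_nonneg)
  qed
  ultimately show ?thesis by (auto simp: psd_def hermitian_def)
qed

subsection \<open>Kronecker products\<close>

lemma kron_dim [simp]:
  "dim_row (kron A B) = dim_row A * dim_row B" "dim_col (kron A B) = dim_col A * dim_col B"
  by (simp_all add: kron_def)

text \<open>A flat tensor index is a pair (quotient, remainder); cutting the range into blocks of
  length \<open>q\<close> turns the sum over flat indices into a double sum.\<close>

lemma sum_div_mod:
  fixes f :: "nat \<Rightarrow> nat \<Rightarrow> 'a :: comm_monoid_add"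
  shows "(\<Sum>k<p * q. f (k div q) (k mod q)) = (\<Sum>a<p. \<Sum>b<q. f a b)"
proof (cases "q = 0")
  case False
  have "(\<Sum>k<p * q. f (k div q) (k mod q)) = (\<Sum>a<p. \<Sum>k\<in>{a * q..<a * q + q}. f (k div q) (k mod q))"
    by (rule sum.nat_group[symmetric])
  also have "\<dots> = (\<Sum>a<p. \<Sum>b<q. f a b)"
  proof (rule sum.cong[OF refl])
    fix a
    have "(\<Sum>k\<in>{0 + a * q..<q + a * q}. f (k div q) (k mod q))
        = (\<Sum>k\<in>{0..<q}. f ((k + a * q) div q) ((k + a * q) mod q))"
      by (rule sum.shift_bounds_nat_ivl)
    also have "\<dots> = (\<Sum>b<q. f a b)"
      using False by (intro sum.cong) auto
    finally show "(\<Sum>k\<in>{a * q..<a * q + q}. f (k div q) (k mod q)) = (\<Sum>b<q. f a b)"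
      by (simp add: add.commute)
  qed
  finally show ?thesis .
qed simp

lemma div_mod_less: "(i :: nat) < m * n \<Longrightarrow> i div n < m" "(i :: nat) < m * n \<Longrightarrow> i mod n < n"
  by (auto simp: less_mult_imp_div_less) (metis mod_less_divisor mult_0_right not_gr_zero not_less0)

lemma kron_index [simp]:
  "i < dim_row A * dim_row B \<Longrightarrow> j < dim_col A * dim_col B \<Longrightarrow>
    kron A B $$ (i,j) = A $$ (i div dim_row B, j div dim_col B) * B $$ (i mod dim_row B, j mod dim_col B)"
  by (simp add: kron_def)

text \<open>The mixed-product rule: once the inner index is split into quotient and remainder, the
  double sum factors.\<close>

lemma kron_mult:
  assumes "dim_col A = dim_row C" "dim_col B = dim_row D"
  shows "kron A B * kron C D = kron (A * C) (B * D)"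
proof (rule eq_matI)
  fix i j assume "i < dim_row (kron (A * C) (B * D))" "j < dim_col (kron (A * C) (B * D))"
  then have i: "i < dim_row A * dim_row B" and j: "j < dim_col C * dim_col D" by auto
  note b = div_mod_less[OF i] div_mod_less[OF j]
  have "(kron A B * kron C D) $$ (i,j)
      = (\<Sum>k<dim_row C * dim_row D. A $$ (i div dim_row B, k div dim_row D) * C $$ (k div dim_row D, j div dim_col D)
          * (B $$ (i mod dim_row B, k mod dim_row D) * D $$ (k mod dim_row D, j mod dim_col D)))"
    using assms i j by (simp add: mult_index_sum mult_ac del: index_mult_mat(1))
  also have "\<dots> = (\<Sum>a<dim_row C. \<Sum>b<dim_row D. A $$ (i div dim_row B, a) * C $$ (a, j div dim_col D)
          * (B $$ (i mod dim_row B, b) * D $$ (b, j mod dim_col D)))"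
    by (rule sum_div_mod)
  also have "\<dots> = kron (A * C) (B * D) $$ (i,j)"
    using assms i j b by (simp add: mult_index_sum sum_product del: index_mult_mat(1))
  finally show "(kron A B * kron C D) $$ (i,j) = kron (A * C) (B * D) $$ (i,j)" .
qed auto

lemma adj_kron: "adj (kron A B) = kron (adj A) (adj B)"
  by (rule eq_matI) (auto simp: div_mod_less)

lemma kron_one_left [simp]: "kron (1\<^sub>m 1) X = X"
proof -
  have "dim_row X = 0 \<Longrightarrow> False" if "i < dim_row X" for i using that by simp
  then show ?thesis by (intro eq_matI) auto
qed

lemma kron_one_one: "kron (1\<^sub>m m) (1\<^sub>m n) = 1\<^sub>m (m * n)"
proof (rule eq_matI)
  fix i j assume "i < dim_row (1\<^sub>m (m * n) :: complex mat)" "j < dim_col (1\<^sub>m (m * n) :: complex mat)"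
  then have ij: "i < m * n" "j < m * n" by auto
  have "i = j \<longleftrightarrow> i div n = j div n \<and> i mod n = j mod n" by (metis div_mult_mod_eq)
  then show "kron (1\<^sub>m m) (1\<^sub>m n) $$ (i,j) = (1\<^sub>m (m * n)) $$ (i,j)"
    using ij div_mod_less[OF ij(1)] div_mod_less[OF ij(2)] by auto
qed auto

lemma kron_zero_left: "kron (0\<^sub>m m n) X = 0\<^sub>m (m * dim_row X) (n * dim_col X)"
  by (rule eq_matI) (auto simp: div_mod_less)

lemma kron_msum_left: "kron (msum m n f I) X = msum (m * dim_row X) (n * dim_col X) (\<lambda>i. kron (f i) X) I"
  if "\<And>i. i \<in> I \<Longrightarrow> f i \<in> carrier_mat m n"
proof (rule eq_matI)
  fix x y assume "x < dim_row (msum (m * dim_row X) (n * dim_col X) (\<lambda>i. kron (f i) X) I)"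
    "y < dim_col (msum (m * dim_row X) (n * dim_col X) (\<lambda>i. kron (f i) X) I)"
  moreover have "\<And>i. i \<in> I \<Longrightarrow> dim_row (f i) = m" "\<And>i. i \<in> I \<Longrightarrow> dim_col (f i) = n"
    using that by auto
  ultimately show "kron (msum m n f I) X $$ (x,y)
      = msum (m * dim_row X) (n * dim_col X) (\<lambda>i. kron (f i) X) I $$ (x,y)"
    by (simp add: div_mod_less sum_distrib_right)
qed auto

section \<open>Isometries from the second factor into the tensor product\<close>

definition ket :: "complex vec \<Rightarrow> complex mat" where
  "ket v = mat (dim_vec v) 1 (\<lambda>(i,j). v $ i)"

text \<open>The isometry \<open>|v\<rangle> \<otimes> I\<close> from the second factor into the tensor product.\<close>
definition embed :: "nat \<Rightarrow> complex vec \<Rightarrow> complex mat" where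
  "embed n v = kron (ket v) (1\<^sub>m n)"

lemma ket_dim [simp]: "dim_row (ket v) = dim_vec v" "dim_col (ket v) = 1"
  by (simp_all add: ket_def)

lemma ketbra_ket: "ketbra v w = ket v * adj (ket w)"
  by (rule eq_matI) (auto simp: ketbra_def ket_def mult_index_sum simp del: index_mult_mat(1))

lemma embed_dim [simp]: "dim_row (embed n v) = dim_vec v * n" "dim_col (embed n v) = n"
  by (simp_all add: embed_def)

text \<open>Reading \<open>X\<close> as \<open>kron (1\<^sub>m 1) X\<close> makes the three factors
  composable, and the mixed-product rule does the rest.\<close>

lemma kron_ketbra:
  assumes "dim_row X = n" "dim_col X = n"
  shows "kron (ketbra v w) X = embed n v * X * adj (embed n w)"
proof -
  have "embed n v * X * adj (embed n w) = kron (ket v) (1\<^sub>m n) * kron (1\<^sub>m 1) X * kron (adj (ket w)) (1\<^sub>m n)"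
    by (simp add: embed_def adj_kron del: One_nat_def)
  also have "\<dots> = kron (ket v * 1\<^sub>m 1 * adj (ket w)) (1\<^sub>m n * X * 1\<^sub>m n)"
    using assms by (simp add: kron_mult)
  also have "\<dots> = kron (ketbra v w) X" using assms by (simp add: ketbra_ket)
  finally show ?thesis by simp
qed

text \<open>The product is the inner product of \<open>e i\<close> and \<open>e j\<close>, as a 1 x
  1 matrix, tensored with the identity.\<close>

lemma adj_embed_mult:
  assumes e: "orthonormal_basis na e" and ij: "i < na" "j < na"
  shows "adj (embed nb (e i)) * embed nb (e j) = (if i = j then 1\<^sub>m nb else 0\<^sub>m nb nb)"
proof -
  have dv: "dim_vec (e i) = na" "dim_vec (e j) = na"
    and ip: "conjugate (e i) \<bullet> e j = (if i = j then 1 else 0)"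
    using e ij by (auto simp: orthonormal_basis_def)
  have "adj (ket (e i)) * ket (e j) = (if i = j then 1\<^sub>m 1 else 0\<^sub>m 1 1)"
    using ip dv by (intro eq_matI)
      (auto simp: mult_index_sum ket_def scalar_prod_def atLeast0LessThan simp del: index_mult_mat(1))
  then show ?thesis
    unfolding embed_def adj_kron using dv
    by (subst kron_mult) (auto simp: kron_zero_left)
qed

text \<open>Resolution of the identity. Orthonormality says U^* U = 1 for the matrix U with columns
  \<open>e i\<close>; as U is square, U U^* = 1 as well, and this is the sum of the
  projectors.\<close>

lemma embed_complete:
  assumes e: "orthonormal_basis na e"
  shows "msum (na * nb) (na * nb) (\<lambda>i. embed nb (e i) * adj (embed nb (e i))) {..<na} = 1\<^sub>m (na * nb)"
proof -
  have dv: "dim_vec (e i) = na" if "i < na" for i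
    using e that by (auto simp: orthonormal_basis_def)
  define U where "U = mat na na (\<lambda>(i,j). e j $ i)"
  have "adj U * U = 1\<^sub>m na"
  proof (rule eq_matI)
    fix i j assume "i < dim_row (1\<^sub>m na :: complex mat)" "j < dim_col (1\<^sub>m na :: complex mat)"
    then have ij: "i < na" "j < na" by auto
    have "conjugate (e i) \<bullet> e j = (if i = j then 1 else 0)"
      using e ij by (auto simp: orthonormal_basis_def)
    then show "(adj U * U) $$ (i,j) = 1\<^sub>m na $$ (i,j)"
      using ij dv by (simp add: mult_index_sum U_def scalar_prod_def atLeast0LessThan del: index_mult_mat(1))
  qed (auto simp: U_def)
  then have "unitary na U" by (simp add: unitary_def U_def)
  then have "U * adj U = 1\<^sub>m na" by (rule unitaryD)
  moreover have "U * adj U = msum na na (\<lambda>i. ketbra (e i) (e i)) {..<na}"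
    using dv by (intro eq_matI) (auto simp: mult_index_sum U_def ketbra_def simp del: index_mult_mat(1))
  ultimately have "kron (msum na na (\<lambda>i. ketbra (e i) (e i)) {..<na}) (1\<^sub>m nb) = 1\<^sub>m (na * nb)"
    by (simp add: kron_one_one)
  moreover have "kron (msum na na (\<lambda>i. ketbra (e i) (e i)) {..<na}) (1\<^sub>m nb)
      = msum (na * nb) (na * nb) (\<lambda>i. kron (ketbra (e i) (e i)) (1\<^sub>m nb)) {..<na}"
    using dv by (subst kron_msum_left) (auto simp: ketbra_def)
  ultimately show ?thesis by (simp add: kron_ketbra)
qed

subsection \<open>Block diagonal operators and partial incoherent states\<close>

text \<open>The blocks belong to the subspaces spanned by \<open>e i\<close> tensored with the
  second space. These need not be coordinate subspaces, so the operator is assembled from embeddings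
  instead of block matrices.\<close>

definition block_diag :: "nat \<Rightarrow> nat \<Rightarrow> (nat \<Rightarrow> complex vec) \<Rightarrow> (nat \<Rightarrow> complex mat) \<Rightarrow> complex mat" where
  "block_diag na nb e X =
     msum (na * nb) (na * nb) (\<lambda>i. embed nb (e i) * X i * adj (embed nb (e i))) {..<na}"

text \<open>The diagonal block of \<open>S\<close> at \<open>v\<close>; with \<open>v = e i\<close>
  and \<open>S = msqrt \<rho>\<close> it is the K_i of the overview.\<close>

definition compress :: "nat \<Rightarrow> complex vec \<Rightarrow> complex mat \<Rightarrow> complex mat" where
  "compress nb v S = adj (embed nb v) * S * embed nb v"

lemma block_diag_cong: "(\<And>i. i < na \<Longrightarrow> X i = Y i) \<Longrightarrow> block_diag na nb e X = block_diag na nb e Y"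
  unfolding block_diag_def by (rule msum_cong) simp

lemma orthonormal_basis_dim: "orthonormal_basis na e \<Longrightarrow> i < na \<Longrightarrow> dim_vec (e i) = na"
  by (auto simp: orthonormal_basis_def)

lemma psd_compress:
  assumes "psd (dim_vec v * nb) S"
  shows "psd nb (compress nb v S)"
  using psd_congr[OF assms, of "embed nb v"] by (simp add: compress_def)

lemma psd_block_diag:
  assumes e: "orthonormal_basis na e" and X: "\<And>i. i < na \<Longrightarrow> psd nb (X i)"
  shows "psd (na * nb) (block_diag na nb e X)"
  unfolding block_diag_def
proof (rule psd_msum)
  fix i assume "i \<in> {..<na}"
  then have i: "i < na" by simp
  show "psd (na * nb) (embed nb (e i) * X i * adj (embed nb (e i)))"
    using psd_congr[OF X[OF i], of "adj (embed nb (e i))"] orthonormal_basis_dim[OF e i] by simp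
qed

lemma block_diag_square:
  assumes e: "orthonormal_basis na e" and X: "\<And>i. i < na \<Longrightarrow> X i \<in> carrier_mat nb nb"
  shows "block_diag na nb e X * block_diag na nb e X = block_diag na nb e (\<lambda>i. X i * X i)"
proof -
  define V where "V i = embed nb (e i)" for i
  have dV: "dim_row (V i) = na * nb" "dim_col (V i) = nb" if "i < na" for i
    using orthonormal_basis_dim[OF e that] by (simp_all add: V_def)
  have dX: "dim_row (X i) = nb" "dim_col (X i) = nb" if "i < na" for i
    using X[OF that] by auto
  \<comment> \<open>Reassociated so that V_i^* V_j stands in the middle, where orthonormality
    evaluates it.\<close>
  have prod: "V i * X i * adj (V i) * (V j * X j * adj (V j)) = V i * (X i * (adj (V i) * V j) * X j) * adj (V j)"
    if "i < na" "j < na" for i j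
    using that by (simp add: mult_assoc_dim dV dX)
  have VV: "adj (V i) * V j = (if i = j then 1\<^sub>m nb else 0\<^sub>m nb nb)" if "i < na" "j < na" for i j
    unfolding V_def by (rule adj_embed_mult[OF e that])
  have "block_diag na nb e X * block_diag na nb e X
      = msum (na * nb) (na * nb) (\<lambda>i. V i * X i * adj (V i) * (V i * X i * adj (V i))) {..<na}"
    unfolding block_diag_def V_def[symmetric]
  proof (rule msum_mult_orthogonal)
    fix i j assume "i \<in> {..<na}" "j \<in> {..<na}" "i \<noteq> j"
    then show "V i * X i * adj (V i) * (V j * X j * adj (V j)) = 0\<^sub>m (na * nb) (na * nb)"
      by (simp add: prod VV dV dX)
  qed (simp, (rule carrier_matI; simp add: dV)+)
  also have "\<dots> = block_diag na nb e (\<lambda>i. X i * X i)"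
    unfolding block_diag_def V_def[symmetric]
  proof (rule msum_cong)
    fix i assume "i \<in> {..<na}"
    then have i: "i < na" by simp
    show "V i * X i * adj (V i) * (V i * X i * adj (V i)) = V i * (X i * X i) * adj (V i)"
      unfolding prod[OF i i] VV[OF i i] by (simp add: dX[OF i])
  qed
  finally show ?thesis .
qed

text \<open>The right-hand side is positive and has the correct square, so uniqueness of the
  positive root applies.\<close>

lemma msqrt_block_diag:
  assumes e: "orthonormal_basis na e" and X: "\<And>i. i < na \<Longrightarrow> psd nb (X i)"
  shows "msqrt (block_diag na nb e (\<lambda>i. X i * X i)) = block_diag na nb e X"
proof -
  have "block_diag na nb e X * block_diag na nb e X = block_diag na nb e (\<lambda>i. X i * X i)"
    by (rule block_diag_square[OF e psdD(1)[OF X]])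
  then show ?thesis using msqrt_square[OF psd_block_diag[where X = X, OF e X]] by simp
qed

text \<open>For the trace pairing, compression is dual to forming block diagonal operators:
  cyclicity moves V_i^* to the front, next to \<open>S\<close>.\<close>

lemma trace_mult_block_diag:
  assumes e: "orthonormal_basis na e" and S: "S \<in> carrier_mat (na * nb) (na * nb)"
    and X: "\<And>i. i < na \<Longrightarrow> X i \<in> carrier_mat nb nb"
  shows "trace (S * block_diag na nb e X) = (\<Sum>i<na. trace (compress nb (e i) S * X i))"
proof -
  define V where "V i = embed nb (e i)" for i
  have dV: "dim_row (V i) = na * nb" "dim_col (V i) = nb" if "i < na" for i
    using orthonormal_basis_dim[OF e that] by (simp_all add: V_def)
  have dX: "dim_row (X i) = nb" "dim_col (X i) = nb" if "i < na" for i
    using X[OF that] by auto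
  have dS: "dim_row S = na * nb" "dim_col S = na * nb" using S by auto
  have "trace (S * block_diag na nb e X)
      = trace (msum (na * nb) (na * nb) (\<lambda>i. S * (V i * X i * adj (V i))) {..<na})"
  proof -
    have "V i * X i * adj (V i) \<in> carrier_mat (na * nb) (na * nb)" if "i \<in> {..<na}" for i
      using that by (intro carrier_matI) (simp_all add: dV)
    from msum_mult_left[where I = "{..<na}" and f = "\<lambda>i. V i * X i * adj (V i)", OF this S]
    show ?thesis unfolding block_diag_def V_def[symmetric] by simp
  qed
  also have "\<dots> = (\<Sum>i<na. trace (S * (V i * X i * adj (V i))))"
    by (rule trace_msum, rule carrier_matI) (simp_all add: dV dS)
  also have "\<dots> = (\<Sum>i<na. trace (compress nb (e i) S * X i))"
  proof (rule sum.cong[OF refl])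
    fix i assume "i \<in> {..<na}"
    then have i: "i < na" by simp
    have "trace (S * (V i * X i * adj (V i))) = trace ((S * V i * X i) * adj (V i))"
      by (simp add: mult_assoc_dim dV[OF i] dX[OF i] dS)
    also have "\<dots> = trace (adj (V i) * (S * V i * X i))"
      by (rule trace_mult_comm) (simp_all add: dV[OF i] dX[OF i] dS)
    also have "adj (V i) * (S * V i * X i) = compress nb (e i) S * X i"
      unfolding compress_def V_def[symmetric] by (simp add: mult_assoc_dim dV[OF i] dX[OF i] dS)
    finally show "trace (S * (V i * X i * adj (V i))) = trace (compress nb (e i) S * X i)" .
  qed
  finally show ?thesis .
qed

lemma msum_kron_ketbra:
  assumes "\<And>i. i < na \<Longrightarrow> s i \<in> carrier_mat nb nb"
  shows "msum (na*nb) (na*nb) (\<lambda>i. complex_of_real (p i) \<cdot>\<^sub>m kron (ketbra (e i) (e i)) (s i)) {..<na}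
      = block_diag na nb e (\<lambda>i. complex_of_real (p i) \<cdot>\<^sub>m s i)"
proof -
  have "complex_of_real r \<cdot>\<^sub>m kron (ketbra (e i) (e i)) Y
      = embed nb (e i) * (complex_of_real r \<cdot>\<^sub>m Y) * adj (embed nb (e i))"
    if "Y \<in> carrier_mat nb nb" for r Y i
    using that by (simp add: kron_ketbra smult_mult_left smult_mult_right)
  then show ?thesis
    unfolding block_diag_def by (intro msum_cong) (simp add: assms)
qed

text \<open>With \<open>X\<^sub>i = \<surd>(p\<^sub>i \<sigma>\<^sub>i)\<close> the normalisations of \<open>p\<close> and of all \<open>\<sigma>\<^sub>i\<close> become a single unit sphere
  condition; a vanishing \<open>X\<^sub>i\<close> is matched by \<open>p\<^sub>i = 0\<close> and the maximally mixed \<open>\<sigma>\<^sub>i\<close>.\<close>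
lemma partial_incoherent_iff:
  assumes e: "orthonormal_basis na e" and nb: "nb > 0"
  shows "\<sigma> \<in> partial_incoherent na nb e \<longleftrightarrow>
    (\<exists>X. (\<forall>i<na. psd nb (X i)) \<and> (\<Sum>i<na. frob2 (X i)) = 1 \<and>
         \<sigma> = block_diag na nb e (\<lambda>i. X i * X i))" (is "?L \<longleftrightarrow> ?R")
proof
  assume ?L
  then obtain p s where p: "\<forall>i<na. 0 \<le> p i" "(\<Sum>i<na. p i) = 1" and s: "\<forall>i<na. density_op nb (s i)"
    and \<sigma>: "\<sigma> = msum (na*nb) (na*nb) (\<lambda>i. complex_of_real (p i) \<cdot>\<^sub>m kron (ketbra (e i) (e i)) (s i)) {..<na}"
    unfolding partial_incoherent_def by blast
  have s': "psd nb (s i)" "trace (s i) = 1" if "i < na" for i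
    using s that by (auto simp: density_op_def)
  have sc: "s i \<in> carrier_mat nb nb" if "i < na" for i by (rule psdD(1)[OF s'(1)[OF that]])
  define X where "X i = complex_of_real (sqrt (p i)) \<cdot>\<^sub>m msqrt (s i)" for i
  have X: "psd nb (X i)" if "i < na" for i
    unfolding X_def by (rule psd_smult[OF msqrt_psd(1)[OF s'(1)[OF that]]]) (use p that in auto)
  have sq: "X i * X i = complex_of_real (p i) \<cdot>\<^sub>m s i" if "i < na" for i
  proof -
    note r = msqrt_psd[OF s'(1)[OF that]]
    have "X i * X i = (complex_of_real (sqrt (p i) * sqrt (p i))) \<cdot>\<^sub>m (msqrt (s i) * msqrt (s i))"
      unfolding X_def of_real_mult
      by (simp add: smult_mult_left smult_mult_right psdD[OF r(1)] smult_smult_mat del: of_real_mult)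
    also have "sqrt (p i) * sqrt (p i) = p i" using p that by simp
    finally show ?thesis by (simp add: r(2))
  qed
  have "frob2 (X i) = p i" if "i < na" for i
  proof -
    have "complex_of_real (frob2 (X i)) = trace (complex_of_real (p i) \<cdot>\<^sub>m s i)"
      using trace_psd_square[OF X[OF that]] sq[OF that] by simp
    then show ?thesis using s'[OF that] psdD[OF s'(1)[OF that]] by (simp add: trace_smult)
  qed
  moreover have "\<sigma> = block_diag na nb e (\<lambda>i. complex_of_real (p i) \<cdot>\<^sub>m s i)"
    unfolding \<sigma> by (rule msum_kron_ketbra) (rule sc)
  then have "\<sigma> = block_diag na nb e (\<lambda>i. X i * X i)"
    using block_diag_cong[of na "\<lambda>i. X i * X i" "\<lambda>i. complex_of_real (p i) \<cdot>\<^sub>m s i"] sq by simp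
  ultimately show ?R using X p by (intro exI[of _ X]) simp
next
  assume ?R
  then obtain X where X: "\<And>i. i < na \<Longrightarrow> psd nb (X i)" and n: "(\<Sum>i<na. frob2 (X i)) = 1"
    and \<sigma>: "\<sigma> = block_diag na nb e (\<lambda>i. X i * X i)" by blast
  define s where "s i = (if frob2 (X i) = 0 then complex_of_real (1 / real nb) \<cdot>\<^sub>m 1\<^sub>m nb
      else complex_of_real (1 / frob2 (X i)) \<cdot>\<^sub>m (X i * X i))" for i
  have "psd nb (1\<^sub>m nb)" using psd_adj_mult[of "1\<^sub>m nb"] by simp
  then have mixed: "density_op nb (complex_of_real (1 / real nb) \<cdot>\<^sub>m 1\<^sub>m nb)"
    using nb psd_smult[of nb "1\<^sub>m nb" "1 / real nb"]
    by (simp add: density_op_def trace_smult) (simp add: trace_def)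
  have s: "density_op nb (s i)" if "i < na" for i
  proof (cases "frob2 (X i) = 0")
    case True
    then show ?thesis using mixed by (simp add: s_def)
  next
    case False
    have "trace (X i * X i) = complex_of_real (frob2 (X i))" by (rule trace_psd_square[OF X[OF that]])
    with False show ?thesis
      using psd_smult[OF psd_square[OF X[OF that]], of "1 / frob2 (X i)"] frob2_nonneg[of "X i"]
        psdD[OF X[OF that]]
      by (simp add: s_def density_op_def trace_smult)
  qed
  have sq: "complex_of_real (frob2 (X i)) \<cdot>\<^sub>m s i = X i * X i" if "i < na" for i
  proof (cases "frob2 (X i) = 0")
    case True
    then have "X i = 0\<^sub>m nb nb" by (simp add: frob2_eq_0 psdD[OF X[OF that]])
    with True show ?thesis by (auto simp: s_def)
  next
    case False
    then show ?thesis by (simp add: s_def smult_smult_mat)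
  qed
  have sc: "s i \<in> carrier_mat nb nb" if "i < na" for i
    using s[OF that] psdD(1) by (auto simp: density_op_def)
  have "\<sigma> = block_diag na nb e (\<lambda>i. complex_of_real (frob2 (X i)) \<cdot>\<^sub>m s i)"
    unfolding \<sigma> by (rule block_diag_cong) (simp add: sq)
  also have "\<dots> = msum (na*nb) (na*nb)
      (\<lambda>i. complex_of_real (frob2 (X i)) \<cdot>\<^sub>m kron (ketbra (e i) (e i)) (s i)) {..<na}"
    by (rule msum_kron_ketbra[symmetric]) (rule sc)
  finally have "\<sigma> = \<dots>" .
  with n s show ?L unfolding partial_incoherent_def
    by (auto intro!: exI[of _ "\<lambda>i. frob2 (X i)"] exI[of _ s] simp: frob2_nonneg)
qed

section \<open>The coherence side: the largest affinity\<close>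

lemma affinity_block_diag:
  assumes e: "orthonormal_basis na e" and \<rho>: "psd (na * nb) \<rho>" and X: "\<And>i. i < na \<Longrightarrow> psd nb (X i)"
  shows "affinity \<rho> (block_diag na nb e (\<lambda>i. X i * X i))
    = (\<Sum>i<na. Re (trace (adj (compress nb (e i) (msqrt \<rho>)) * X i)))"
proof -
  note S = msqrt_psd(1)[OF \<rho>]
  \<comment> \<open>The compressions are hermitian, so the adjoint may be inserted; it puts the
    trace into the form that \<open>trace_adj_mult_le\<close> and \<open>trace_adj_mult\<close>
    expect.\<close>
  have "adj (compress nb (e i) (msqrt \<rho>)) = compress nb (e i) (msqrt \<rho>)" if "i < na" for i
    using psd_compress[of "e i" nb "msqrt \<rho>"] S orthonormal_basis_dim[OF e that] psdD(4) by simp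
  then show ?thesis
    by (simp add: affinity_def msqrt_block_diag[OF e X] trace_mult_block_diag[OF e psdD(1)[OF S] psdD(1)[OF X]])
qed

text \<open>Allows division by the square root of this sum when the optimal state is
  normalized.\<close>

lemma sum_frob2_compress_pos:
  assumes e: "orthonormal_basis na e" and \<rho>: "density_op (na * nb) \<rho>"
  shows "(\<Sum>i<na. frob2 (compress nb (e i) (msqrt \<rho>))) > 0"
proof (rule ccontr)
  assume neg: "\<not> ?thesis"
  have p: "psd (na * nb) \<rho>" and tr: "trace \<rho> = 1" using \<rho> by (auto simp: density_op_def)
  note S = msqrt_psd(1)[OF p]
  have "(\<Sum>i<na. frob2 (compress nb (e i) (msqrt \<rho>))) = 0"
    using neg by (intro antisym) (auto simp: sum_nonneg frob2_nonneg)
  then have "frob2 (compress nb (e i) (msqrt \<rho>)) = 0" if "i < na" for i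
    using that by (subst (asm) sum_nonneg_eq_0_iff) (auto simp: frob2_nonneg)
  then have z: "compress nb (e i) (msqrt \<rho>) = 0\<^sub>m nb nb" if "i < na" for i
    using that by (simp add: frob2_eq_0 compress_def)
  \<comment> \<open>The identity is block diagonal with identity blocks, so pairing it with the root
    of \<open>\<rho>\<close> writes the trace of that root as the sum of the block traces.\<close>
  have "block_diag na nb e (\<lambda>_. 1\<^sub>m nb) = 1\<^sub>m (na * nb)"
    using embed_complete[OF e, of nb] by (simp add: block_diag_def)
  then have "trace (msqrt \<rho>) = (\<Sum>i<na. trace (compress nb (e i) (msqrt \<rho>) * 1\<^sub>m nb))"
    using trace_mult_block_diag[OF e psdD(1)[OF S], of "\<lambda>_. 1\<^sub>m nb"] psdD[OF S] by simp
  also have "\<dots> = 0" using z by (simp add: trace_def)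
  finally have "msqrt \<rho> = 0\<^sub>m (na * nb) (na * nb)" by (rule psd_trace_0[OF S])
  then have "\<rho> = 0\<^sub>m (na * nb) (na * nb)" using msqrt_psd(2)[OF p] by simp
  with tr show False by (simp add: trace_def)
qed

lemma coh_A_eq:
  assumes \<rho>: "density_op (na * nb) \<rho>" and e: "orthonormal_basis na e"
  shows "coh_A na nb e \<rho> = 1 - (\<Sum>i<na. frob2 (compress nb (e i) (msqrt \<rho>)))"
proof -
  define K where "K i = compress nb (e i) (msqrt \<rho>)" for i
  define c where "c = (\<Sum>i<na. frob2 (K i))"
  have c: "c > 0" unfolding c_def K_def by (rule sum_frob2_compress_pos[OF e \<rho>])
  have p: "psd (na * nb) \<rho>" and tr: "trace \<rho> = 1" using \<rho> by (auto simp: density_op_def)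
  \<comment> \<open>A matrix of size 0 has trace 0, not 1. Positivity of \<open>nb\<close> makes the
    maximally mixed state available for blocks of weight zero.\<close>
  have nb: "nb > 0"
    using tr psdD(2)[OF p] by (cases "nb = 0") (auto simp: trace_def)
  have K: "psd nb (K i)" if "i < na" for i
    unfolding K_def using orthonormal_basis_dim[OF e that] msqrt_psd(1)[OF p]
    by (intro psd_compress) simp
  note aff = affinity_block_diag[OF e p, folded K_def]
  note PI = partial_incoherent_iff[OF e nb]
  have upper: "(affinity \<rho> \<sigma>)\<^sup>2 \<le> c" if \<sigma>: "\<sigma> \<in> partial_incoherent na nb e" for \<sigma>
  proof -
    obtain X where X: "\<And>i. i < na \<Longrightarrow> psd nb (X i)" and n: "(\<Sum>i<na. frob2 (X i)) = 1"
      and \<sigma>_eq: "\<sigma> = block_diag na nb e (\<lambda>i. X i * X i)" using \<sigma> unfolding PI by blast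
    \<comment> \<open>With \<open>t\<close> equal to the affinity itself, the summed inequality
      reads 2 t^2 <= c + t^2, that is t^2 <= c.\<close>
    define t where "t = affinity \<rho> \<sigma>"
    have "t = (\<Sum>i<na. Re (trace (adj (K i) * X i)))" unfolding t_def \<sigma>_eq by (rule aff[OF X])
    then have "2 * t * t = (\<Sum>i<na. 2 * t * Re (trace (adj (K i) * X i)))"
      by (simp only: sum_distrib_left)
    also have "\<dots> \<le> (\<Sum>i<na. frob2 (K i) + t\<^sup>2 * frob2 (X i))"
    proof (rule sum_mono)
      fix i assume "i \<in> {..<na}"
      then have i: "i < na" by simp
      show "2 * t * Re (trace (adj (K i) * X i)) \<le> frob2 (K i) + t\<^sup>2 * frob2 (X i)"
        by (rule trace_adj_mult_le) (simp_all add: psdD[OF K[OF i]] psdD[OF X[OF i]])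
    qed
    also have "\<dots> = c + t\<^sup>2" using n by (simp add: c_def sum.distrib flip: sum_distrib_left)
    finally show ?thesis by (simp add: t_def power2_eq_square)
  qed
  \<comment> \<open>The equality case of Cauchy-Schwarz; the factor 1 / sqrt c makes the squared
    norms of the blocks add up to 1.\<close>
  define X where "X i = complex_of_real (1 / sqrt c) \<cdot>\<^sub>m K i" for i
  have X: "psd nb (X i)" if "i < na" for i
    unfolding X_def by (rule psd_smult[OF K[OF that]]) (use c in simp)
  have "(\<Sum>i<na. frob2 (X i)) = (1 / c) * (\<Sum>i<na. frob2 (K i))"
    unfolding X_def frob2_smult sum_distrib_left
    using c by (simp add: norm_divide power_divide)
  then have n: "(\<Sum>i<na. frob2 (X i)) = 1" using c by (simp add: c_def)
  define \<sigma> where "\<sigma> = block_diag na nb e (\<lambda>i. X i * X i)"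
  have mem: "\<sigma> \<in> partial_incoherent na nb e" unfolding PI using X n \<sigma>_def by blast
  have "affinity \<rho> \<sigma> = (\<Sum>i<na. Re (trace (adj (K i) * X i)))" unfolding \<sigma>_def by (rule aff[OF X])
  also have "\<dots> = (\<Sum>i<na. (1 / sqrt c) * frob2 (K i))"
    unfolding X_def by (simp add: smult_mult_right trace_smult trace_adj_mult del: of_real_divide)
  also have "\<dots> = c / sqrt c" by (simp add: c_def sum_divide_distrib)
  finally have "(affinity \<rho> \<sigma>)\<^sup>2 = c" using c by (simp add: power_divide power2_eq_square)
  \<comment> \<open>The bound is attained at \<open>\<sigma>\<close>, so the infimum is a
    minimum.\<close>
  then have "coh_A na nb e \<rho> = 1 - c"
    unfolding coh_A_def
    using upper mem by (intro cInf_eq_minimum) (auto intro!: image_eqI[of _ _ \<sigma>])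
  then show ?thesis by (simp add: c_def K_def)
qed

section \<open>The measurement side: success probability of the least square measurement\<close>

lemma P_lsm_eq:
  assumes \<rho>: "density_op (na * nb) \<rho>" and e: "orthonormal_basis na e"
  shows "P_lsm (na * nb) na (omega na nb e \<rho>) (eta na nb e \<rho>)
    = 1 - (\<Sum>i<na. frob2 (compress nb (e i) (msqrt \<rho>)))"
proof -
  have p: "psd (na * nb) \<rho>" using \<rho> by (auto simp: density_op_def)
  define S where "S = msqrt \<rho>"
  define V where "V i = embed nb (e i)" for i
  \<comment> \<open>The unnormalized ensemble member eta_i omega_i, free of any division.\<close>
  define G where "G i = S * (V i * adj (V i)) * S" for i
  define \<eta> where "\<eta> = eta na nb e \<rho>"
  have S: "psd (na * nb) S" and SS: "S * S = \<rho>" using msqrt_psd[OF p] by (simp_all add: S_def)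
  note dS = psdD[OF S]
  have dV: "dim_row (V i) = na * nb" "dim_col (V i) = nb" if "i < na" for i
    using orthonormal_basis_dim[OF e that] by (simp_all add: V_def)
  have kron: "kron (ketbra (e i) (e i)) (1\<^sub>m nb) = V i * adj (V i)" for i
    by (simp add: kron_ketbra V_def)
  have \<omega>: "omega na nb e \<rho> i = complex_of_real (1 / \<eta> i) \<cdot>\<^sub>m G i" for i
    by (simp add: omega_def kron S_def G_def \<eta>_def)
  \<comment> \<open>As a squared norm, the weight can vanish only if \<open>S * V i\<close>
    does.\<close>
  have \<eta>: "\<eta> i = frob2 (S * V i)" if i: "i < na" for i
  proof -
    have "trace (V i * adj (V i) * \<rho>) = trace (V i * (adj (V i) * S * S))"
      unfolding SS[symmetric] using i by (simp add: mult_assoc_dim dV dS)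
    also have "\<dots> = trace (adj (V i) * S * S * V i)"
      using i by (intro trace_mult_comm) (simp_all add: dV dS)
    also have "adj (V i) * S * S * V i = adj (S * V i) * (S * V i)"
      using i by (simp add: mult_assoc_dim dV dS)
    finally show ?thesis by (simp add: \<eta>_def eta_def kron trace_adj_mult)
  qed
  \<comment> \<open>This reconciles the convention 1 / 0 = 0 in \<open>omega\<close> with the
    unnormalized operator: where the weight is zero, both are zero.\<close>
  have G0: "G i = 0\<^sub>m (na * nb) (na * nb)" if "i < na" "\<eta> i = 0" for i
  proof -
    have "S * V i = 0\<^sub>m (na * nb) nb"
      using that \<eta>[OF that(1)] by (simp add: frob2_eq_0 dV dS)
    moreover have "G i = S * V i * (adj (V i) * S)"
      using that by (simp add: G_def mult_assoc_dim dV dS)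
    ultimately show ?thesis using that by (simp add: dV dS)
  qed
  have \<eta>\<omega>: "complex_of_real (\<eta> i) \<cdot>\<^sub>m omega na nb e \<rho> i = G i" if "i < na" for i
  proof (cases "\<eta> i = 0")
    case True
    then show ?thesis using that by (simp add: \<omega> G0)
  next
    case False
    then show ?thesis by (simp add: \<omega> smult_smult_mat)
  qed
  have "rho_out (na * nb) na (omega na nb e \<rho>) \<eta> = msum (na * nb) (na * nb) G {..<na}"
    unfolding rho_out_def by (rule msum_cong) (simp add: \<eta>\<omega>)
  also have "\<dots> = msum (na * nb) (na * nb) (\<lambda>i. S * (V i * adj (V i))) {..<na} * S"
  proof -
    have "S * (V i * adj (V i)) \<in> carrier_mat (na * nb) (na * nb)" if "i \<in> {..<na}" for i
      using that by (intro carrier_matI) (simp_all add: dV dS)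
    from msum_mult_right[where I = "{..<na}" and f = "\<lambda>i. S * (V i * adj (V i))", OF this dS(1)]
    show ?thesis unfolding G_def[abs_def] by simp
  qed
  also have "msum (na * nb) (na * nb) (\<lambda>i. S * (V i * adj (V i))) {..<na}
      = S * msum (na * nb) (na * nb) (\<lambda>i. V i * adj (V i)) {..<na}"
  proof -
    have "V i * adj (V i) \<in> carrier_mat (na * nb) (na * nb)" if "i \<in> {..<na}" for i
      using that by (intro carrier_matI) (simp_all add: dV)
    from msum_mult_left[where I = "{..<na}" and f = "\<lambda>i. V i * adj (V i)", OF this dS(1)]
    show ?thesis by simp
  qed
  also have "\<dots> = S" unfolding V_def embed_complete[OF e] by (simp add: dS)
  finally have out: "rho_out (na * nb) na (omega na nb e \<rho>) \<eta> = \<rho>" by (simp add: SS)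
  define R where "R = minvsqrt \<rho>"
  define P where "P = R * S"
  note RS = minvsqrt_msqrt[OF p, folded R_def S_def, folded P_def]
  have dR: "dim_row R = na * nb" "dim_col R = na * nb" using RS(1) by auto
  have dP: "dim_row P = na * nb" "dim_col P = na * nb" by (simp_all add: P_def dR dS)
  \<comment> \<open>The inverse roots on the outside meet the roots inside \<open>G i\<close>; left
    and right both give the support projection, because root and inverse root commute.\<close>
  have lsm: "lsm (na * nb) na (omega na nb e \<rho>) \<eta> i = P * (V i * adj (V i)) * P" if i: "i < na" for i
  proof -
    have "lsm (na * nb) na (omega na nb e \<rho>) \<eta> i
        = R * (complex_of_real (\<eta> i) \<cdot>\<^sub>m omega na nb e \<rho> i) * R"
      unfolding lsm_def out Let_def R_def[symmetric]
      using i by (simp add: smult_mult_left smult_mult_right dR \<omega> G_def dS)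
    also have "\<dots> = (R * S) * (V i * adj (V i)) * (S * R)"
      unfolding \<eta>\<omega>[OF i] G_def using i by (simp add: mult_assoc_dim dR dS dV)
    finally show ?thesis by (simp add: P_def RS(2))
  qed
  have summand: "\<eta> i * Re (trace (lsm (na * nb) na (omega na nb e \<rho>) \<eta> i * omega na nb e \<rho> i))
      = frob2 (compress nb (e i) S)" if i: "i < na" for i
  proof -
    define Q where "Q = V i * adj (V i)"
    have dQ: "dim_row Q = na * nb" "dim_col Q = na * nb" using i by (simp_all add: Q_def dV)
    have G: "G i = S * Q * S" by (simp add: G_def Q_def)
    have d\<omega>: "dim_row (omega na nb e \<rho> i) = na * nb" "dim_col (omega na nb e \<rho> i) = na * nb"
      by (simp_all add: \<omega> G dS)
    \<comment> \<open>The prior is moved onto the second copy of \<open>omega\<close>, which becomes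
      \<open>G i\<close> too.\<close>
    have "complex_of_real (\<eta> i) * trace (lsm (na * nb) na (omega na nb e \<rho>) \<eta> i * omega na nb e \<rho> i)
        = trace (lsm (na * nb) na (omega na nb e \<rho>) \<eta> i * (complex_of_real (\<eta> i) \<cdot>\<^sub>m omega na nb e \<rho> i))"
      unfolding lsm[OF i] Q_def[symmetric]
      by (simp add: smult_mult_right trace_smult d\<omega> dP dQ)
    also have "\<dots> = trace (P * (Q * P * S * Q * S))"
      unfolding \<eta>\<omega>[OF i] lsm[OF i] G Q_def[symmetric]
      by (simp add: mult_assoc_dim dP dS dQ)
    also have "\<dots> = trace (Q * P * S * Q * S * P)"
      by (rule trace_mult_comm) (simp_all add: dP dS dQ)
    \<comment> \<open>Cyclicity has brought the leading \<open>P\<close> to the end, so each support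
      projection now touches an \<open>S\<close> that absorbs it.\<close>
    also have "Q * P * S * Q * S * P = Q * (P * S) * Q * (S * P)"
      by (simp add: mult_assoc_dim dP dS dQ)
    also have "\<dots> = V i * (adj (V i) * S * V i * adj (V i) * S)"
      unfolding RS(3,4) Q_def using i by (simp add: mult_assoc_dim dS dV)
    also have "trace \<dots> = trace (adj (V i) * S * V i * adj (V i) * S * V i)"
      using i by (intro trace_mult_comm) (simp_all add: dV dS)
    also have "adj (V i) * S * V i * adj (V i) * S * V i = compress nb (e i) S * compress nb (e i) S"
      using i by (simp add: compress_def V_def[symmetric] mult_assoc_dim dV dS)
    also have "trace \<dots> = complex_of_real (frob2 (compress nb (e i) S))"
      by (rule trace_psd_square[OF psd_compress]) (use S i in \<open>simp add: orthonormal_basis_dim[OF e]\<close>)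
    finally have "Re (complex_of_real (\<eta> i) * trace (lsm (na * nb) na (omega na nb e \<rho>) \<eta> i * omega na nb e \<rho> i))
        = frob2 (compress nb (e i) S)" by simp
    then show ?thesis by simp
  qed
  show ?thesis
    unfolding P_lsm_def \<eta>_def[symmetric] S_def[symmetric] using summand by simp
qed

theorem theorem6:
  fixes na nb :: nat and \<rho> :: "complex mat" and e :: "nat \<Rightarrow> complex vec"
  assumes "density_op (na * nb) \<rho>"
    and "orthonormal_basis na e"
  shows "coh_A na nb e \<rho> = P_lsm (na * nb) na (omega na nb e \<rho>) (eta na nb e \<rho>)"
  using coh_A_eq[OF assms] P_lsm_eq[OF assms] by simp

end
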